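(* Let $(Q,I)$ be a gentle presentation with $Q$ finite and connected, and let $A=\Bbbk Q/I$. The following four statements are equivalent: (a) the algebra $A$ is finite-dimensional; (b) $\mathrm{HH}^0(A)$ is finite-dimensional; (c) $\mathrm{HH}^1(A)$ is finite-dimensional; (d) there is no cocomplete cycle in $(Q,I)$. When they hold, $\mathrm{HH}^m(A)$ is finite-dimensional for all $m\ge0$.
   Context: $\Bbbk$ is a field and $\mathrm{HH}^*(A)$ is Hochschild cohomology over $\Bbbk$. Paths in $Q=(Q_0,Q_1,s,t)$ are composed from right to left. $(Q,I)$ is a gentle presentation: $I$ is an ideal of $\Bbbk Q$ generated by paths of length $2$; every vertex is the source of at most two and the target of at most two arrows; for every arrow $a$ there is at most one arrow $b$ with $t(b)=s(a)$ and $ab\notin I$, at most one arrow $c$ with $t(a)=s(c)$ and $ca\notin I$, at most one arrow $b$ with $t(b)=s(a)$ and $ab\in I$, and at most one arrow $c$ with $t(a)=s(c)$ and $ca\in I$. (The ideal is not required to be admissible.) A cycle is a path of positive length with equal source and target. A cycle $C$ is cocomplete if the path $C^2$ has no subpath of length $2$ lying in $I$. *)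

theory Defs
  imports
    "HOL-Algebra.QuotRing"
    "HOL-Library.Sublist"
    "Graph_Theory.Graph_Theory"
    "Jordan_Normal_Form.Missing_VectorSpace"
begin

section \<open>Paths in a quiver\<close>

text \<open>
  A quiver is a directed multigraph; \<^const>\<open>tail\<close> and \<^const>\<open>head\<close> are the source and target maps
  \<open>s\<close> and \<open>t\<close>. A path is a pair \<open>(u, es)\<close> of its source \<open>u\<close> and the list \<open>es\<close> of its arrows in the
  order in which they are traversed; \<open>(u, [])\<close> is the trivial path at \<open>u\<close>. Since paths are composed
  from right to left, the path written \<open>ab\<close> has the arrow list \<open>[b, a]\<close>.
\<close>

type_synonym ('v, 'e) path = "'v \<times> 'e list"

definition quiver_paths :: "('v, 'e) pre_digraph \<Rightarrow> ('v, 'e) path set" where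
  "quiver_paths Q = {(u, es). \<exists>v. pre_digraph.awalk Q u es v}"

definition path_target :: "('v, 'e) pre_digraph \<Rightarrow> ('v, 'e) path \<Rightarrow> 'v" where
  "path_target Q p = last (pre_digraph.awalk_verts Q (fst p) (snd p))"

definition path_comp :: "('v, 'e) path \<Rightarrow> ('v, 'e) path \<Rightarrow> ('v, 'e) path" where
  "path_comp p q = (fst q, snd q @ snd p)"

definition path2 :: "('v, 'e) pre_digraph \<Rightarrow> 'e \<Rightarrow> 'e \<Rightarrow> ('v, 'e) path" where
  "path2 Q a b = (tail Q b, [b, a])"


section \<open>Path algebras and their quotients\<close>

text \<open>
  Elements of the path algebra are the finitely supported functions from paths to the field; the
  product is convolution over all factorizations of a path. The unit is the sum of the trivial paths
  (an element of the carrier if there are finitely many vertices).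
\<close>

definition path_algebra ::
  "('k, 'm) ring_scheme \<Rightarrow> ('v, 'e) pre_digraph \<Rightarrow> ('k, ('v, 'e) path \<Rightarrow> 'k) module" where
  "path_algebra K Q =
    \<lparr>carrier = {f. (\<forall>p \<in> quiver_paths Q. f p \<in> carrier K) \<and>
                   (\<forall>p. p \<notin> quiver_paths Q \<longrightarrow> f p = \<zero>\<^bsub>K\<^esub>) \<and>
                   finite {p. f p \<noteq> \<zero>\<^bsub>K\<^esub>}},
     monoid.mult = (\<lambda>f g r. finsum K (\<lambda>(p, q). f p \<otimes>\<^bsub>K\<^esub> g q)
               {(p, q). p \<in> quiver_paths Q \<and> q \<in> quiver_paths Q \<and>
                        fst p = path_target Q q \<and> path_comp p q = r}),
     one = (\<lambda>p. if p \<in> quiver_paths Q \<and> snd p = [] then \<one>\<^bsub>K\<^esub> else \<zero>\<^bsub>K\<^esub>),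
     zero = (\<lambda>p. \<zero>\<^bsub>K\<^esub>),
     add = (\<lambda>f g p. f p \<oplus>\<^bsub>K\<^esub> g p),
     smult = (\<lambda>c f p. c \<otimes>\<^bsub>K\<^esub> f p)\<rparr>"

definition path_elem :: "('k, 'm) ring_scheme \<Rightarrow> ('v, 'e) path \<Rightarrow> (('v, 'e) path \<Rightarrow> 'k)" where
  "path_elem K p = (\<lambda>q. if q = p then \<one>\<^bsub>K\<^esub> else \<zero>\<^bsub>K\<^esub>)"

text \<open>
  The quotient of an algebra by an ideal, or of a vector space by a subspace: the factor ring (resp.
  its additive part, if the multiplication of \<open>M\<close> is irrelevant) together with the induced scalar
  multiplication \<open>c (x + N) = c x + N\<close>.
\<close>

definition quotient_module ::
  "('k, 'b, 'm) module_scheme \<Rightarrow> 'b set \<Rightarrow> ('k, 'b set) module" where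
  "quotient_module M N =
    ring.extend (M Quot N)
      (module.fields (\<lambda>c X. \<Union>x \<in> X. N +>\<^bsub>M\<^esub> (c \<odot>\<^bsub>M\<^esub> x)))"

definition quiver_algebra ::
  "('k, 'm) ring_scheme \<Rightarrow> ('v, 'e) pre_digraph \<Rightarrow> (('v, 'e) path \<Rightarrow> 'k) set
    \<Rightarrow> ('k, (('v, 'e) path \<Rightarrow> 'k) set) module" where
  "quiver_algebra K Q I = quotient_module (path_algebra K Q) I"


section \<open>Gentle presentations\<close>

definition generated_by_paths2 ::
  "('k, 'm) ring_scheme \<Rightarrow> ('v, 'e) pre_digraph \<Rightarrow> (('v, 'e) path \<Rightarrow> 'k) set \<Rightarrow> bool" where
  "generated_by_paths2 K Q I \<longleftrightarrow>
    (\<exists>R \<subseteq> {p \<in> quiver_paths Q. length (snd p) = 2}.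
       I = genideal (path_algebra K Q) (path_elem K ` R))"

definition gentle_presentation ::
  "('k, 'm) ring_scheme \<Rightarrow> ('v, 'e) pre_digraph \<Rightarrow> (('v, 'e) path \<Rightarrow> 'k) set \<Rightarrow> bool" where
  "gentle_presentation K Q I \<longleftrightarrow>
    wf_digraph Q \<and>
    ideal I (path_algebra K Q) \<and>
    generated_by_paths2 K Q I \<and>
    (\<forall>v \<in> verts Q. finite (out_arcs Q v) \<and> out_degree Q v \<le> 2 \<and>
                   finite (in_arcs Q v) \<and> in_degree Q v \<le> 2) \<and>
    (\<forall>a \<in> arcs Q.
       (\<exists>\<^sub>\<le>\<^sub>1 b. b \<in> arcs Q \<and> head Q b = tail Q a \<and> path_elem K (path2 Q a b) \<notin> I) \<and>
       (\<exists>\<^sub>\<le>\<^sub>1 c. c \<in> arcs Q \<and> head Q a = tail Q c \<and> path_elem K (path2 Q c a) \<notin> I) \<and>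
       (\<exists>\<^sub>\<le>\<^sub>1 b. b \<in> arcs Q \<and> head Q b = tail Q a \<and> path_elem K (path2 Q a b) \<in> I) \<and>
       (\<exists>\<^sub>\<le>\<^sub>1 c. c \<in> arcs Q \<and> head Q a = tail Q c \<and> path_elem K (path2 Q c a) \<in> I))"

text \<open>
  A path of positive length is given by its arrow list alone. A cycle may repeat vertices and arrows,
  unlike in \<^const>\<open>pre_digraph.cycle\<close>.
\<close>

definition quiver_cycle :: "('v, 'e) pre_digraph \<Rightarrow> 'e list \<Rightarrow> bool" where
  "quiver_cycle Q C \<longleftrightarrow> C \<noteq> [] \<and> (\<exists>u. pre_digraph.awalk Q u C u)"

definition cocomplete_cycle ::
  "('k, 'm) ring_scheme \<Rightarrow> ('v, 'e) pre_digraph \<Rightarrow> (('v, 'e) path \<Rightarrow> 'k) set \<Rightarrow> 'e list \<Rightarrow> bool"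
where
  "cocomplete_cycle K Q I C \<longleftrightarrow>
    quiver_cycle Q C \<and>
    (\<forall>a b. sublist [b, a] (C @ C) \<longrightarrow> path_elem K (path2 Q a b) \<notin> I)"


section \<open>Hochschild cohomology\<close>

text \<open>
  The Hochschild complex of a \<open>K\<close>-algebra \<open>A\<close> with coefficients in \<open>A\<close>. Linear maps from the
  \<open>n\<close>-fold tensor power of \<open>A\<close> to \<open>A\<close> are represented by \<open>n\<close>-multilinear maps, defined on the lists
  of length \<open>n\<close> over \<open>A\<close>; for \<open>n = 0\<close> these are the elements of \<open>A\<close>. The multiplicative part of the
  module record plays no role.
\<close>

definition tuples :: "('a, 'm) ring_scheme \<Rightarrow> nat \<Rightarrow> 'a list set" where
  "tuples A n = {xs. length xs = n \<and> set xs \<subseteq> carrier A}"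

definition hochschild_cochains ::
  "('k, 'm) ring_scheme \<Rightarrow> ('k, 'a, 'n) module_scheme \<Rightarrow> nat \<Rightarrow> ('k, 'a list \<Rightarrow> 'a) module" where
  "hochschild_cochains K A n =
    \<lparr>carrier = {f \<in> tuples A n \<rightarrow>\<^sub>E carrier A.
                 \<forall>xs \<in> tuples A n. \<forall>i < n. (\<lambda>x. f (xs[i := x])) \<in> module_hom K A A},
     monoid.mult = undefined,
     one = undefined,
     zero = (\<lambda>xs \<in> tuples A n. \<zero>\<^bsub>A\<^esub>),
     add = (\<lambda>f g. \<lambda>xs \<in> tuples A n. f xs \<oplus>\<^bsub>A\<^esub> g xs),
     smult = (\<lambda>c f. \<lambda>xs \<in> tuples A n. c \<odot>\<^bsub>A\<^esub> f xs)\<rparr>"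

definition signed :: "('a, 'm) ring_scheme \<Rightarrow> nat \<Rightarrow> 'a \<Rightarrow> 'a" where
  "signed A i x = (if even i then x else \<ominus>\<^bsub>A\<^esub> x)"

text \<open>
  \<open>(d f)(x\<^sub>1, \<dots>, x\<^sub>n\<^sub>+\<^sub>1) = x\<^sub>1 f(x\<^sub>2, \<dots>, x\<^sub>n\<^sub>+\<^sub>1)
     + \<Sum>\<^sub>1\<^sub>\<le>\<^sub>i\<^sub>\<le>\<^sub>n (-1)\<^sup>i f(x\<^sub>1, \<dots>, x\<^sub>i x\<^sub>i\<^sub>+\<^sub>1, \<dots>, x\<^sub>n\<^sub>+\<^sub>1)
     + (-1)\<^sup>n\<^sup>+\<^sup>1 f(x\<^sub>1, \<dots>, x\<^sub>n) x\<^sub>n\<^sub>+\<^sub>1\<close>.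
  Lists are indexed from \<open>0\<close>, so \<open>x\<^sub>i\<close> is \<open>xs ! (i - 1)\<close>.
\<close>

definition hochschild_diff ::
  "('k, 'a, 'n) module_scheme \<Rightarrow> nat \<Rightarrow> ('a list \<Rightarrow> 'a) \<Rightarrow> ('a list \<Rightarrow> 'a)" where
  "hochschild_diff A n f = (\<lambda>xs \<in> tuples A (Suc n).
     hd xs \<otimes>\<^bsub>A\<^esub> f (tl xs)
     \<oplus>\<^bsub>A\<^esub> (\<Oplus>\<^bsub>A\<^esub> i \<in> {1..n}. signed A i
            (f (take (i - 1) xs @ [xs ! (i - 1) \<otimes>\<^bsub>A\<^esub> xs ! i] @ drop (i + 1) xs)))
     \<oplus>\<^bsub>A\<^esub> signed A (n + 1) (f (butlast xs) \<otimes>\<^bsub>A\<^esub> last xs))"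

definition hochschild_cocycles ::
  "('k, 'm) ring_scheme \<Rightarrow> ('k, 'a, 'n) module_scheme \<Rightarrow> nat \<Rightarrow> ('a list \<Rightarrow> 'a) set" where
  "hochschild_cocycles K A n =
    {f \<in> carrier (hochschild_cochains K A n).
       hochschild_diff A n f = \<zero>\<^bsub>hochschild_cochains K A (Suc n)\<^esub>}"

fun hochschild_coboundaries ::
  "('k, 'm) ring_scheme \<Rightarrow> ('k, 'a, 'n) module_scheme \<Rightarrow> nat \<Rightarrow> ('a list \<Rightarrow> 'a) set" where
  "hochschild_coboundaries K A 0 = {\<zero>\<^bsub>hochschild_cochains K A 0\<^esub>}"
| "hochschild_coboundaries K A (Suc n) =
    hochschild_diff A n ` carrier (hochschild_cochains K A n)"

definition HH ::
  "('k, 'm) ring_scheme \<Rightarrow> ('k, 'a, 'n) module_scheme \<Rightarrow> nat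
    \<Rightarrow> ('k, ('a list \<Rightarrow> 'a) set) module" where
  "HH K A n =
    quotient_module
      ((hochschild_cochains K A n)\<lparr>carrier := hochschild_cocycles K A n\<rparr>)
      (hochschild_coboundaries K A n)"

end

theory Submission
  imports Defs
begin

text \<open>
  The classes of the reduced paths, i.e. those without a subpath of length 2 in \<open>I\<close>, form a basis
  of \<open>A\<close>. If there is no cocomplete cycle, then no reduced path repeats an arrow, so \<open>A\<close> and hence
  all spaces of Hochschild cochains are finite-dimensional.

  Conversely, let \<open>C\<close> be a cocomplete cycle without repeated arrows. Gentleness forces every reduced
  path that meets \<open>C\<close> to run along \<open>C\<close>, so the sum \<open>z\<^sub>n\<close> of all rotations of \<open>C\<^sup>n\<close> is central, and
  the \<open>z\<^sub>n\<close> span an infinite-dimensional subspace of \<open>HH\<^sup>0(A)\<close>. Counting occurrences of a fixed arrow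
  of \<open>C\<close> in a path defines a derivation \<open>E\<close> with \<open>E z\<^sub>1 = z\<^sub>1\<close>, in every characteristic. Inner
  derivations kill the central element \<open>z\<^sub>1\<close>, whereas the derivations \<open>z\<^sub>n E\<close> map it to
  \<open>z\<^sub>n z\<^sub>1 = z\<^sub>n\<^sub>+\<^sub>1\<close>, so \<open>HH\<^sup>1(A)\<close> is infinite-dimensional.
\<close>

section \<open>Quotients of vector spaces\<close>

text \<open>No basis of \<open>HH\<close> is ever computed. Finite dimension comes from finitely
  many functionals that separate points; infinite dimension comes from a sequence of nonzero
  functionals that vanish on the coboundaries and of which almost all annihilate any given vector.
  The functionals are coefficients at reduced paths, applied to the cochain itself in degree 0 and
  to its value at one central element in degree 1. That \<open>HH\<close> is a quotient of vector
  spaces at all rests on the square of the differential being zero, which is proved by writing the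
  differential as an alternating sum of faces. The derivation counts one arrow because the Euler
  derivation, which counts all arrows, multiplies the sum of the rotations of \<open>C\<close> by
  the length of \<open>C\<close>, and this may be zero in the field. For the count to be one, the
  cycle must not repeat arrows. A cocomplete cycle with a repeated arrow is a power of a shorter
  one, since successors are forced; therefore it is unrolled into a periodic sequence of arrows and
  cut at its least period.\<close>

definition linear_functional ::
  "('k, 'm) ring_scheme \<Rightarrow> ('k, 'a, 'n) module_scheme \<Rightarrow> ('a \<Rightarrow> 'k) \<Rightarrow> bool" where
  "linear_functional K V \<phi> \<longleftrightarrow>
    (\<forall>x \<in> carrier V. \<phi> x \<in> carrier K) \<and>
    (\<forall>x \<in> carrier V. \<forall>y \<in> carrier V. \<phi> (x \<oplus>\<^bsub>V\<^esub> y) = \<phi> x \<oplus>\<^bsub>K\<^esub> \<phi> y) \<and>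
    (\<forall>c \<in> carrier K. \<forall>x \<in> carrier V. \<phi> (c \<odot>\<^bsub>V\<^esub> x) = c \<otimes>\<^bsub>K\<^esub> \<phi> x)"

lemma linear_functionalD:
  assumes "linear_functional K V \<phi>"
  shows "x \<in> carrier V \<Longrightarrow> \<phi> x \<in> carrier K"
    and "\<lbrakk>x \<in> carrier V; y \<in> carrier V\<rbrakk> \<Longrightarrow> \<phi> (x \<oplus>\<^bsub>V\<^esub> y) = \<phi> x \<oplus>\<^bsub>K\<^esub> \<phi> y"
    and "\<lbrakk>c \<in> carrier K; x \<in> carrier V\<rbrakk> \<Longrightarrow> \<phi> (c \<odot>\<^bsub>V\<^esub> x) = c \<otimes>\<^bsub>K\<^esub> \<phi> x"
  using assms unfolding linear_functional_def by blast+

lemma quotient_module_simps: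
  "carrier (quotient_module M N) = (\<lambda>x. N +>\<^bsub>M\<^esub> x) ` carrier M"
  "zero (quotient_module M N) = N"
  "one (quotient_module M N) = N +>\<^bsub>M\<^esub> \<one>\<^bsub>M\<^esub>"
  "add (quotient_module M N) = (<+>\<^bsub>M\<^esub>)"
  "monoid.mult (quotient_module M N) = rcoset_mult M N"
  "smult (quotient_module M N) = (\<lambda>c X. \<Union>x \<in> X. N +>\<^bsub>M\<^esub> (c \<odot>\<^bsub>M\<^esub> x))"
  by (auto simp: quotient_module_def FactRing_simps ring.defs module.defs)

section \<open>Functionals, submodules and cosets\<close>

context module
begin

lemma linear_functional_zero:
  assumes "linear_functional R M \<phi>"
  shows "\<phi> \<zero>\<^bsub>M\<^esub> = \<zero>"
  using linear_functionalD(3)[OF assms, of "\<zero>" "\<zero>\<^bsub>M\<^esub>"] linear_functionalD(1)[OF assms, of "\<zero>\<^bsub>M\<^esub>"]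
  by simp

lemma linear_functional_minus:
  assumes "linear_functional R M \<phi>" "x \<in> carrier M" "y \<in> carrier M"
  shows "\<phi> (x \<ominus>\<^bsub>M\<^esub> y) = \<phi> x \<ominus> \<phi> y"
proof -
  have "\<phi> ((\<ominus> \<one>) \<odot>\<^bsub>M\<^esub> y) = (\<ominus> \<one>) \<otimes> \<phi> y"
    using assms by (intro linear_functionalD(3)) auto
  then have "\<phi> (\<ominus>\<^bsub>M\<^esub> y) = \<ominus> \<phi> y"
    using assms linear_functionalD(1)[OF assms(1,3)] by (simp add: smult_minus_1 R.l_minus)
  then show ?thesis
    using assms linear_functionalD(2)[OF assms(1), of x "\<ominus>\<^bsub>M\<^esub> y"]
    by (simp add: a_minus_def)
qed

text \<open>\<open>submodule\<close> records closure under addition, zero and scalars; negatives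
  come from the scalar -1.\<close>

lemma submodule_add_subgroup:
  assumes "submodule R N M"
  shows "additive_subgroup N M"
proof -
  interpret N: submodule R N M by fact
  have "\<ominus>\<^bsub>M\<^esub> x \<in> N" if "x \<in> N" for x
    using N.smult_closed[of "\<ominus> \<one>" x] smult_minus_1[of x] N.subset that
    by (metis R.add.inv_closed R.one_closed subsetD)
  then show ?thesis
    using N.subset N.zero_closed
    by (intro additive_subgroup.intro M.add.subgroupI) (auto simp: a_inv_def simp del: N.zero_closed)
qed

lemma submodule_abelian_subgroup:
  assumes "submodule R N M"
  shows "abelian_subgroup N M"
  by (intro abelian_subgroupI3 submodule_add_subgroup assms M.abelian_group_axioms)

lemma submodule_minus_closed:
  assumes "submodule R N M" "x \<in> N" "y \<in> N"
  shows "x \<ominus>\<^bsub>M\<^esub> y \<in> N"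
  using assms submodule_add_subgroup[OF assms(1)]
  by (simp add: a_minus_def additive_subgroup.a_inv_closed additive_subgroup.a_closed)

lemma coset_eq_iff:
  assumes "submodule R N M" "x \<in> carrier M" "y \<in> carrier M"
  shows "N +>\<^bsub>M\<^esub> x = N +>\<^bsub>M\<^esub> y \<longleftrightarrow> x \<ominus>\<^bsub>M\<^esub> y \<in> N"
proof -
  interpret N: abelian_subgroup N M using assms(1) by (rule submodule_abelian_subgroup)
  have "N +>\<^bsub>M\<^esub> x = N +>\<^bsub>M\<^esub> y \<longleftrightarrow> x \<in> N +>\<^bsub>M\<^esub> y"
    using N.a_rcos_self[OF assms(2)] N.a_repr_independence'[of x y] assms by auto
  also have "\<dots> \<longleftrightarrow> x \<ominus>\<^bsub>M\<^esub> y \<in> N"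
    using N.a_rcos_module assms by (simp add: a_minus_def)
  finally show ?thesis .
qed

text \<open>The scalar multiple in \<open>quotient_module\<close> is a union over all
  representatives. It collapses to one coset because \<open>c\<close> maps differences lying in
  \<open>N\<close> into \<open>N\<close>.\<close>

lemma coset_smult:
  assumes "submodule R N M" "c \<in> carrier R" "x \<in> carrier M"
  shows "c \<odot>\<^bsub>quotient_module M N\<^esub> (N +>\<^bsub>M\<^esub> x) = N +>\<^bsub>M\<^esub> (c \<odot>\<^bsub>M\<^esub> x)"
proof -
  interpret N: submodule R N M by fact
  interpret Na: abelian_subgroup N M using assms(1) by (rule submodule_abelian_subgroup)
  have "N +>\<^bsub>M\<^esub> (c \<odot>\<^bsub>M\<^esub> y) = N +>\<^bsub>M\<^esub> (c \<odot>\<^bsub>M\<^esub> x)" if "y \<in> N +>\<^bsub>M\<^esub> x" for y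
  proof -
    have y: "y \<in> carrier M" using that Na.a_subset Na.a_elemrcos_carrier assms(3) by blast
    then have "y \<ominus>\<^bsub>M\<^esub> x \<in> N" using Na.a_rcos_module that assms by (simp add: a_minus_def)
    then have "c \<odot>\<^bsub>M\<^esub> (y \<ominus>\<^bsub>M\<^esub> x) \<in> N" using assms by blast
    then show ?thesis
      using assms y by (subst coset_eq_iff) (auto simp: a_minus_def smult_r_distr smult_r_minus)
  qed
  moreover have "x \<in> N +>\<^bsub>M\<^esub> x" using assms by (simp add: Na.a_rcos_self)
  ultimately show ?thesis unfolding quotient_module_simps by blast
qed

lemma coset_add:
  assumes "submodule R N M" "x \<in> carrier M" "y \<in> carrier M"
  shows "(N +>\<^bsub>M\<^esub> x) \<oplus>\<^bsub>quotient_module M N\<^esub> (N +>\<^bsub>M\<^esub> y) = N +>\<^bsub>M\<^esub> (x \<oplus>\<^bsub>M\<^esub> y)"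
  using assms submodule_abelian_subgroup[OF assms(1)]
  by (simp add: quotient_module_simps abelian_subgroup.a_rcos_sum)

lemma quotient_module_is_module:
  assumes N: "submodule R N M"
  shows "module R (quotient_module M N)"
proof (rule moduleI)
  interpret Na: abelian_subgroup N M using assms(1) by (rule submodule_abelian_subgroup)
  let ?Q = "quotient_module M N"
  have zero: "\<zero>\<^bsub>?Q\<^esub> = N +>\<^bsub>M\<^esub> \<zero>\<^bsub>M\<^esub>"
    using Na.a_subset by (simp add: quotient_module_simps(2))
  show "abelian_group ?Q"
  proof (rule abelian_groupI)
    fix X assume "X \<in> carrier ?Q"
    then obtain x where x: "x \<in> carrier M" "X = N +>\<^bsub>M\<^esub> x" by (auto simp: quotient_module_simps(1))
    then have "(N +>\<^bsub>M\<^esub> (\<ominus>\<^bsub>M\<^esub> x)) \<oplus>\<^bsub>?Q\<^esub> X = \<zero>\<^bsub>?Q\<^esub>"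
      using Na.a_subset by (simp add: coset_add N M.l_neg quotient_module_simps(2))
    then show "\<exists>Y \<in> carrier ?Q. Y \<oplus>\<^bsub>?Q\<^esub> X = \<zero>\<^bsub>?Q\<^esub>"
      using x by (intro bexI) (auto simp: quotient_module_simps(1))
  next
    show "\<zero>\<^bsub>?Q\<^esub> \<in> carrier ?Q" using zero by (auto simp: quotient_module_simps(1))
  next
    fix X assume "X \<in> carrier ?Q"
    then show "\<zero>\<^bsub>?Q\<^esub> \<oplus>\<^bsub>?Q\<^esub> X = X"
      unfolding zero by (auto simp: quotient_module_simps(1) coset_add N)
  qed (auto simp: quotient_module_simps(1) coset_add N M.a_ac)
  show "cring R" by (rule R.cring_axioms)
qed (auto simp: quotient_module_simps(1) coset_smult coset_add N smult_l_distr smult_r_distr smult_assoc1)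

lemma module_hom_eq_on_span:
  assumes "module R L" "f \<in> module_hom R M L" "S \<subseteq> carrier M"
    and "\<And>s. s \<in> S \<Longrightarrow> f s = \<zero>\<^bsub>L\<^esub>" "x \<in> span S"
  shows "f x = \<zero>\<^bsub>L\<^esub>"
proof -
  interpret L: module R L by fact
  interpret f: mod_hom R M L f by unfold_locales fact
  have "span S \<subseteq> f.ker"
    using assms by (intro span_is_subset f.ker_is_submodule) (auto simp: f.ker_def)
  then show ?thesis using assms(5) by (auto simp: f.ker_def)
qed

end

section \<open>Dimension tested by linear functionals\<close>

context vectorspace
begin

lemma quotient_module_vectorspace:
  assumes "submodule K N V"
  shows "vectorspace K (quotient_module V N)"
  using quotient_module_is_module[OF assms] by (simp add: vectorspace_def field_axioms)

lemma submodule_vectorspace: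
  assumes "submodule K W V"
  shows "vectorspace K (V\<lparr>carrier := W\<rparr>)"
  using submodule_is_module[OF assms] by (simp add: vectorspace_def field_axioms)

text \<open>Imposing one functional lowers the dimension by at most one. Once \<phi> is removed, the
  remaining functionals separate only the points of the kernel of \<phi> in \<open>W\<close>, so the
  induction has to allow arbitrary submodules \<open>W\<close>.\<close>

lemma separated_submodule_finite_span:
  assumes "finite \<Phi>" "\<And>\<phi>. \<phi> \<in> \<Phi> \<Longrightarrow> linear_functional K V \<phi>" "submodule K W V"
    and "\<And>w. w \<in> W \<Longrightarrow> (\<And>\<phi>. \<phi> \<in> \<Phi> \<Longrightarrow> \<phi> w = \<zero>\<^bsub>K\<^esub>) \<Longrightarrow> w = \<zero>\<^bsub>V\<^esub>"
  shows "\<exists>S. finite S \<and> S \<subseteq> W \<and> W \<subseteq> span S"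
  using assms
proof (induction \<Phi> arbitrary: W rule: finite_induct)
  case empty
  then have "W \<subseteq> {\<zero>\<^bsub>V\<^esub>}" by auto
  moreover have "\<zero>\<^bsub>V\<^esub> \<in> span {}"
    using span_is_submodule[of "{}"] submodule.zero_closed by blast
  ultimately show ?case by (intro exI[of _ "{}"]) auto
next
  case (insert \<phi> \<Phi>)
  interpret W: submodule K W V by fact
  have \<phi>: "linear_functional K V \<phi>" using insert.prems by simp
  note \<phi>D = linear_functionalD[OF \<phi>]
  define W' where "W' = {w \<in> W. \<phi> w = \<zero>\<^bsub>K\<^esub>}"
  have W': "submodule K W' V"
    using W.subset by unfold_locales (auto simp: W'_def \<phi>D linear_functional_zero[OF \<phi>] subset_iff)
  obtain S where S: "finite S" "S \<subseteq> W'" "W' \<subseteq> span S"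
    using insert.IH[OF _ W'] insert.prems by (force simp: W'_def)
  show ?case
  proof (cases "W' = W")
    case True
    then show ?thesis using S by blast
  next
    case False
    then obtain v where v: "v \<in> W" "\<phi> v \<noteq> \<zero>\<^bsub>K\<^esub>" by (auto simp: W'_def)
    then have vV: "v \<in> carrier V" using W.subset by auto
    then have unit: "\<phi> v \<in> Units K" using v \<phi>D(1) by (simp add: field_Units)
    have sub: "insert v S \<subseteq> carrier V" using S(2) v W.subset by (auto simp: W'_def)
    interpret T: submodule K "span (insert v S)" V by (rule span_is_submodule[OF sub])
    have "w \<in> span (insert v S)" if w: "w \<in> W" for w
    proof -
      have wV: "w \<in> carrier V" using w W.subset by auto
      \<comment> \<open>Chosen such that \<open>w\<close> minus \<open>c\<close> times
        \<open>v\<close> lies in the kernel \<open>W'\<close>, which \<open>S\<close> already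
        spans.\<close>
      define c where "c = \<phi> w \<otimes>\<^bsub>K\<^esub> inv\<^bsub>K\<^esub> \<phi> v"
      have c: "c \<in> carrier K" using \<phi>D(1)[OF wV] unit by (simp add: c_def)
      have "\<phi> (c \<odot>\<^bsub>V\<^esub> v) = \<phi> w"
        using c vV unit \<phi>D(1)[OF wV] \<phi>D(1)[OF vV] by (simp add: \<phi>D(3) c_def m_assoc)
      then have "\<phi> (w \<ominus>\<^bsub>V\<^esub> c \<odot>\<^bsub>V\<^esub> v) = \<zero>\<^bsub>K\<^esub>"
        using linear_functional_minus[OF \<phi> wV, of "c \<odot>\<^bsub>V\<^esub> v"] c vV \<phi>D(1)[OF wV]
        by (simp add: a_minus_def R.r_neg)
      moreover have "w \<ominus>\<^bsub>V\<^esub> c \<odot>\<^bsub>V\<^esub> v \<in> W"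
        using w v c by (intro submodule_minus_closed insert.prems) auto
      ultimately have "w \<ominus>\<^bsub>V\<^esub> c \<odot>\<^bsub>V\<^esub> v \<in> span (insert v S)"
        using S(3) span_is_monotone[of S "insert v S"] by (auto simp: W'_def)
      moreover have "v \<in> span (insert v S)" using in_own_span[OF sub] by auto
      ultimately have "(w \<ominus>\<^bsub>V\<^esub> c \<odot>\<^bsub>V\<^esub> v) \<oplus>\<^bsub>V\<^esub> c \<odot>\<^bsub>V\<^esub> v \<in> span (insert v S)" using c by auto
      then show ?thesis using wV vV c by (simp add: a_minus_def M.a_assoc M.l_neg)
    qed
    then show ?thesis
      using S v by (intro exI[of _ "insert v S"]) (auto simp: W'_def)
  qed
qed

lemma fin_dim_if_separated:
  assumes "finite \<Phi>" "\<And>\<phi>. \<phi> \<in> \<Phi> \<Longrightarrow> linear_functional K V \<phi>"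
    and "\<And>w. w \<in> carrier V \<Longrightarrow> (\<And>\<phi>. \<phi> \<in> \<Phi> \<Longrightarrow> \<phi> w = \<zero>\<^bsub>K\<^esub>) \<Longrightarrow> w = \<zero>\<^bsub>V\<^esub>"
  shows fin_dim
proof -
  have "submodule K (carrier V) V" by unfold_locales auto
  from separated_submodule_finite_span[OF assms(1,2) this assms(3)]
  obtain S where S: "finite S" "S \<subseteq> carrier V" "carrier V \<subseteq> span S" by blast
  then have "span S = carrier V" using span_is_subset2 by blast
  then show ?thesis unfolding fin_dim_def using S by blast
qed

lemma quotient_fin_dim:
  assumes fin_dim and N: "submodule K N V"
  shows "vectorspace.fin_dim K (quotient_module V N)"
proof -
  let ?U = "quotient_module V N"
  interpret U: vectorspace K ?U using N by (rule quotient_module_vectorspace)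
  have "(\<lambda>x. N +>\<^bsub>V\<^esub> x) \<in> module_hom K V ?U"
    by (auto simp: module_hom_def coset_add[OF N] coset_smult[OF N] quotient_module_simps(1))
  then interpret p: linear_map K V ?U "\<lambda>x. N +>\<^bsub>V\<^esub> x"
    by unfold_locales
  show ?thesis
    by (rule p.rank_nullity_main(2)[OF assms(1)]) (simp add: quotient_module_simps)
qed

text \<open>Every vector is annihilated by almost all \<open>\<psi> n\<close>, so some \<open>\<psi> n\<close> annihilates a given finite
  generating set of the quotient, although \<open>\<psi> n\<close> is nonzero.\<close>

lemma quotient_not_fin_dim:
  assumes N: "submodule K N V"
    and \<psi>: "\<And>n::nat. linear_functional K V (\<psi> n)"
    and \<psi>N: "\<And>n x. x \<in> N \<Longrightarrow> \<psi> n x = \<zero>\<^bsub>K\<^esub>"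
    and ev: "\<And>x. x \<in> carrier V \<Longrightarrow> \<exists>n0. \<forall>n\<ge>n0. \<psi> n x = \<zero>\<^bsub>K\<^esub>"
    and nz: "\<And>n. \<exists>x \<in> carrier V. \<psi> n x \<noteq> \<zero>\<^bsub>K\<^esub>"
  shows "\<not> vectorspace.fin_dim K (quotient_module V N)"
proof
  let ?U = "quotient_module V N"
  interpret U: vectorspace K ?U using N by (rule quotient_module_vectorspace)
  assume "U.fin_dim"
  then obtain T where T: "finite T" "T \<subseteq> carrier ?U" "U.span T = carrier ?U"
    unfolding U.fin_dim_def by blast
  then obtain T0 where T0: "finite T0" "T0 \<subseteq> carrier V" "T = (\<lambda>x. N +>\<^bsub>V\<^esub> x) ` T0"
    unfolding quotient_module_simps(1) by (meson finite_subset_image)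
  have "\<exists>n. \<forall>t \<in> T0. \<psi> n t = \<zero>\<^bsub>K\<^esub>"
  proof -
    from ev T0 obtain m where m: "\<And>t n. t \<in> T0 \<Longrightarrow> n \<ge> m t \<Longrightarrow> \<psi> n t = \<zero>\<^bsub>K\<^esub>"
      by (metis subsetD)
    \<comment> \<open>The inserted 0 keeps the maximum defined when \<open>T0\<close> is
      empty.\<close>
    have "\<psi> (Max (insert 0 (m ` T0))) t = \<zero>\<^bsub>K\<^esub>" if "t \<in> T0" for t
      using that T0(1) by (intro m) auto
    then show ?thesis by blast
  qed
  then obtain n where n: "\<And>t. t \<in> T0 \<Longrightarrow> \<psi> n t = \<zero>\<^bsub>K\<^esub>" by blast
  note \<psi>D = linear_functionalD[OF \<psi>[of n]]
  \<comment> \<open>The image of the kernel of \<open>\<psi> n\<close> is a submodule containing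
    \<open>T\<close>, hence the whole quotient. As \<open>\<psi> n\<close> vanishes on
    \<open>N\<close>, it would then vanish on all of \<open>V\<close>.\<close>
  define W where "W = (\<lambda>x. N +>\<^bsub>V\<^esub> x) ` {x \<in> carrier V. \<psi> n x = \<zero>\<^bsub>K\<^esub>}"
  have "submodule K W ?U"
  proof (rule submodule.intro)
    show "module K ?U" by unfold_locales
    show "W \<subseteq> carrier ?U" by (auto simp: W_def quotient_module_simps(1))
    show "v \<oplus>\<^bsub>?U\<^esub> w \<in> W" if "v \<in> W" "w \<in> W" for v w
    proof -
      from that obtain x y where "v = N +>\<^bsub>V\<^esub> x" "w = N +>\<^bsub>V\<^esub> y" "x \<in> carrier V" "y \<in> carrier V"
        "\<psi> n x = \<zero>\<^bsub>K\<^esub>" "\<psi> n y = \<zero>\<^bsub>K\<^esub>" unfolding W_def by blast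
      then show ?thesis unfolding W_def
        by (intro image_eqI[of _ _ "x \<oplus>\<^bsub>V\<^esub> y"]) (auto simp: coset_add[OF N] \<psi>D)
    qed
    have "N = N +>\<^bsub>V\<^esub> \<zero>\<^bsub>V\<^esub>" using submodule.subset[OF N] by simp
    then show "\<zero>\<^bsub>?U\<^esub> \<in> W"
      unfolding W_def quotient_module_simps(2)
      by (rule image_eqI) (auto simp: linear_functional_zero[OF \<psi>])
    show "c \<odot>\<^bsub>?U\<^esub> v \<in> W" if "c \<in> carrier K" "v \<in> W" for c v
    proof -
      from that obtain x where "v = N +>\<^bsub>V\<^esub> x" "x \<in> carrier V" "\<psi> n x = \<zero>\<^bsub>K\<^esub>" unfolding W_def by blast
      then show ?thesis using that unfolding W_def
        by (intro image_eqI[of _ _ "c \<odot>\<^bsub>V\<^esub> x"]) (auto simp: coset_smult[OF N] \<psi>D)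
    qed
  qed
  moreover have "T \<subseteq> W" using T0 n by (auto simp: W_def)
  ultimately have "carrier ?U \<subseteq> W" using U.span_is_subset T(3) by blast
  obtain x where x: "x \<in> carrier V" "\<psi> n x \<noteq> \<zero>\<^bsub>K\<^esub>" using nz by blast
  then have "N +>\<^bsub>V\<^esub> x \<in> W" using \<open>carrier ?U \<subseteq> W\<close> by (auto simp: quotient_module_simps(1))
  then obtain y where y: "y \<in> carrier V" "\<psi> n y = \<zero>\<^bsub>K\<^esub>" "N +>\<^bsub>V\<^esub> x = N +>\<^bsub>V\<^esub> y" by (auto simp: W_def)
  then have "\<psi> n (x \<ominus>\<^bsub>V\<^esub> y) = \<zero>\<^bsub>K\<^esub>" using x coset_eq_iff[OF N] \<psi>N by blast
  then have "\<psi> n x = \<zero>\<^bsub>K\<^esub>"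
    using x y linear_functional_minus[OF \<psi>[of n]] \<psi>D(1)[OF x(1)] by (simp add: a_minus_def)
  then show False using x by blast
qed

end


section \<open>The Hochschild complex\<close>

lemma tuples_Suc: "xs \<in> tuples A (Suc n) \<longleftrightarrow> (\<exists>x ys. xs = x # ys \<and> x \<in> carrier A \<and> ys \<in> tuples A n)"
  by (auto simp: tuples_def length_Suc_conv)

lemma tuples_0: "tuples A 0 = {[]}"
  by (auto simp: tuples_def)

lemma tuples_nth: "xs \<in> tuples A n \<Longrightarrow> i < n \<Longrightarrow> xs ! i \<in> carrier A"
  by (auto simp: tuples_def subset_iff)

lemma tuples_update: "xs \<in> tuples A n \<Longrightarrow> x \<in> carrier A \<Longrightarrow> xs[i := x] \<in> tuples A n"
  using set_update_subset_insert[of xs i x] by (auto simp: tuples_def)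

section \<open>Cancellation in alternating double sums\<close>

context abelian_group
begin

lemma signed_closed [simp]: "x \<in> carrier G \<Longrightarrow> signed G i x \<in> carrier G"
  by (simp add: signed_def)

lemma signed_zero [simp]: "signed G i \<zero> = \<zero>"
  by (simp add: signed_def)

lemma signed_add:
  "x \<in> carrier G \<Longrightarrow> y \<in> carrier G \<Longrightarrow> signed G i (x \<oplus> y) = signed G i x \<oplus> signed G i y"
  by (simp add: signed_def minus_add)

lemma signed_signed: "x \<in> carrier G \<Longrightarrow> signed G i (signed G j x) = signed G (i + j) x"
  by (auto simp: signed_def)

lemma signed_finsum:
  "finite I \<Longrightarrow> f \<in> I \<rightarrow> carrier G \<Longrightarrow> signed G j (\<Oplus>i\<in>I. f i) = (\<Oplus>i\<in>I. signed G j (f i))"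
  by (induction I rule: finite_induct) (auto simp: signed_add Pi_def)

text \<open>The hypothesis on \<open>F\<close> pairs each entry with \<open>i < j\<close> with one
  of the remaining entries, of opposite sign. In the induction the range grows by the column
  \<open>i = Suc N\<close> and the row \<open>j = Suc (Suc N)\<close>; the row repeats the entries
  of the column with all signs reversed, so the two new sums cancel.\<close>

lemma alternating_double_sum_zero:
  assumes "\<And>j i. j \<le> Suc N \<Longrightarrow> i \<le> N \<Longrightarrow> F j i \<in> carrier G"
    and "\<And>i j. i < j \<Longrightarrow> j \<le> Suc N \<Longrightarrow> F j i = F i (j - 1)"
  shows "(\<Oplus>j\<in>{..Suc N}. signed G j (\<Oplus>i\<in>{..N}. signed G i (F j i))) = \<zero>"
  using assms
proof (induction N)
  case 0
  have "F 1 0 = F 0 0" "F 0 0 \<in> carrier G" using 0 by auto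
  then have "signed G 1 (\<Oplus>i\<in>{..0}. signed G i (F 1 i)) = \<ominus> F 0 0"
    "signed G 0 (\<Oplus>i\<in>{..0}. signed G i (F 0 i)) = F 0 0" by (simp_all add: signed_def)
  then show ?case using \<open>F 0 0 \<in> carrier G\<close> by (subst finsum_Suc) (auto simp: l_neg le_Suc_eq)
next
  case (Suc N)
  have F[simp]: "F j i \<in> carrier G" if "j \<le> Suc (Suc N)" "i \<le> Suc N" for j i
    using Suc.prems(1) that by auto
  let ?S = "\<lambda>j. \<Oplus>i\<in>{..N}. signed G i (F j i)"
  let ?c = "\<Oplus>j\<in>{..Suc N}. signed G (Suc N + j) (F j (Suc N))"
  have S[simp]: "?S j \<in> carrier G" if "j \<le> Suc (Suc N)" for j using that by (intro finsum_closed) auto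
  have c[simp]: "?c \<in> carrier G" by (intro finsum_closed) auto
  have inner: "(\<Oplus>i\<in>{..Suc N}. signed G i (F j i)) = signed G (Suc N) (F j (Suc N)) \<oplus> ?S j"
    if "j \<le> Suc (Suc N)" for j
    using that by (subst finsum_Suc) auto
  have "(\<Oplus>j\<in>{..Suc N}. signed G j (\<Oplus>i\<in>{..Suc N}. signed G i (F j i))) =
        (\<Oplus>j\<in>{..Suc N}. signed G (Suc N + j) (F j (Suc N)) \<oplus> signed G j (?S j))"
    by (rule finsum_cong') (auto simp: inner signed_add signed_signed add.commute)
  also have "\<dots> = ?c \<oplus> (\<Oplus>j\<in>{..Suc N}. signed G j (?S j))"
    by (rule finsum_addf) auto
  also have "(\<Oplus>j\<in>{..Suc N}. signed G j (?S j)) = \<zero>"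
    using Suc.prems by (intro Suc.IH) auto
  finally have A: "(\<Oplus>j\<in>{..Suc N}. signed G j (\<Oplus>i\<in>{..Suc N}. signed G i (F j i))) = ?c"
    by simp
  have "signed G (Suc (Suc N)) (\<Oplus>i\<in>{..Suc N}. signed G i (F (Suc (Suc N)) i)) =
     (\<Oplus>i\<in>{..Suc N}. signed G (Suc (Suc N)) (signed G i (F (Suc (Suc N)) i)))"
    by (rule signed_finsum) auto
  also have "\<dots> = (\<Oplus>i\<in>{..Suc N}. signed G 1 (signed G (Suc N + i) (F i (Suc N))))"
    using Suc.prems(2)[of _ "Suc (Suc N)"] by (intro finsum_cong') (auto simp: signed_signed)
  also have "\<dots> = signed G 1 ?c" by (rule signed_finsum[symmetric]) auto
  finally have B: "signed G (Suc (Suc N)) (\<Oplus>i\<in>{..Suc N}. signed G i (F (Suc (Suc N)) i)) = \<ominus> ?c"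
    by (simp add: signed_def)
  have "(\<Oplus>i\<in>{..Suc N}. signed G i (F j i)) \<in> carrier G" if "j \<le> Suc (Suc N)" for j
    using that by (intro finsum_closed) auto
  then have "(\<Oplus>j\<in>{..Suc (Suc N)}. signed G j (\<Oplus>i\<in>{..Suc N}. signed G i (F j i))) = \<ominus> ?c \<oplus> ?c"
    unfolding B[symmetric] unfolding A[symmetric] by (intro finsum_Suc) (auto simp del: finsum_Suc)
  then show ?case using l_neg[OF c] by simp
qed

end

section \<open>Faces of the Hochschild complex\<close>

definition merge :: "('a, 'm) ring_scheme \<Rightarrow> nat \<Rightarrow> 'a list \<Rightarrow> 'a list" where
  "merge A k xs = take k xs @ [xs ! k \<otimes>\<^bsub>A\<^esub> xs ! Suc k] @ drop (Suc (Suc k)) xs"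

lemma length_merge: "Suc k < length xs \<Longrightarrow> length (merge A k xs) = length xs - 1"
  by (simp add: merge_def)

lemma nth_merge:
  assumes "Suc k < length xs" "i < length xs - 1"
  shows "merge A k xs ! i =
    (if i < k then xs ! i else if i = k then xs ! k \<otimes>\<^bsub>A\<^esub> xs ! Suc k else xs ! Suc i)"
  using assms by (auto simp: merge_def nth_append nth_Cons' Suc_diff_Suc)

text \<open>Prepares the multilinearity of the inner faces: a change of one entry survives the merge
  as a change of one entry. Both merged positions end up in entry \<open>p\<close>, through a right
  or a left multiplication by the neighbour.\<close>

lemma merge_update:
  assumes "Suc p < length xs" "k < length xs"
  shows "merge A p (xs[k := x]) =
    (if k < p then (merge A p xs)[k := x]
     else if k = p then (merge A p xs)[p := x \<otimes>\<^bsub>A\<^esub> xs ! Suc p]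
     else if k = Suc p then (merge A p xs)[p := xs ! p \<otimes>\<^bsub>A\<^esub> x]
     else (merge A p xs)[k - 1 := x])"
  using assms by (intro nth_equalityI) (auto simp: length_merge nth_merge nth_list_update)

lemma merge_Cons: "Suc k < length xs \<Longrightarrow> merge A (Suc k) (x # xs) = x # merge A k xs"
  by (simp add: merge_def)

lemma merge_butlast:
  assumes "Suc (Suc k) < length xs"
  shows "butlast (merge A k xs) = merge A k (butlast xs)" "last (merge A k xs) = last xs"
proof -
  show "butlast (merge A k xs) = merge A k (butlast xs)"
    using assms by (intro nth_equalityI) (auto simp: length_merge nth_merge nth_butlast)
  show "last (merge A k xs) = last xs"
    using assms by (simp add: merge_def last_append)
qed

text \<open>Collecting all summands of \<open>hochschild_diff\<close> in one indexed family turns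
  the square of the differential into an alternating double sum. Indices 0 and \<open>Suc n\<close>
  are the outer multiplications; the inner summand \<open>Suc k\<close> uses
  \<open>merge A k\<close> because lists are indexed from 0.\<close>

definition hochschild_face ::
  "('k, 'a, 'n) module_scheme \<Rightarrow> nat \<Rightarrow> nat \<Rightarrow> ('a list \<Rightarrow> 'a) \<Rightarrow> 'a list \<Rightarrow> 'a" where
  "hochschild_face A n i f xs =
    (case i of 0 \<Rightarrow> hd xs \<otimes>\<^bsub>A\<^esub> f (tl xs)
     | Suc k \<Rightarrow> if k < n then f (merge A k xs) else f (butlast xs) \<otimes>\<^bsub>A\<^esub> last xs)"

locale assoc_algebra = vectorspace K A + A: ring A for K and A (structure) +
  assumes smult_mult_left:
      "\<lbrakk>c \<in> carrier K; x \<in> carrier A; y \<in> carrier A\<rbrakk> \<Longrightarrow> (c \<odot> x) \<otimes> y = c \<odot> (x \<otimes> y)"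
    and smult_mult_right:
      "\<lbrakk>c \<in> carrier K; x \<in> carrier A; y \<in> carrier A\<rbrakk> \<Longrightarrow> x \<otimes> (c \<odot> y) = c \<odot> (x \<otimes> y)"
begin

lemma tuples_tl: "xs \<in> tuples A (Suc n) \<Longrightarrow> tl xs \<in> tuples A n"
  and tuples_hd: "xs \<in> tuples A (Suc n) \<Longrightarrow> hd xs \<in> carrier A"
  and tuples_butlast: "xs \<in> tuples A (Suc n) \<Longrightarrow> butlast xs \<in> tuples A n"
  and tuples_last: "xs \<in> tuples A (Suc n) \<Longrightarrow> last xs \<in> carrier A"
proof -
  assume xs: "xs \<in> tuples A (Suc n)"
  then have "xs \<noteq> []" by (auto simp: tuples_def)
  with xs show "tl xs \<in> tuples A n" "hd xs \<in> carrier A" "butlast xs \<in> tuples A n" "last xs \<in> carrier A"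
    by (auto simp: tuples_def subset_iff dest: list.set_sel(2) in_set_butlastD)
qed

lemma tuples_merge: "xs \<in> tuples A (Suc n) \<Longrightarrow> k < n \<Longrightarrow> merge A k xs \<in> tuples A n"
  using tuples_nth[of xs A "Suc n"]
  by (auto simp: tuples_def merge_def dest: in_set_takeD in_set_dropD intro!: A.m_closed)

lemmas tuples_intros = tuples_tl tuples_hd tuples_butlast tuples_last tuples_merge

text \<open>For \<open>j = Suc i\<close> both sides multiply three neighbours, so this is
  associativity. Otherwise the merged positions are disjoint and only the index shifts.\<close>

lemma merge_merge:
  assumes "xs \<in> tuples A (Suc (Suc n))" "i < j" "j < Suc n"
  shows "merge A i (merge A j xs) = merge A (j - 1) (merge A i xs)"
  using assms tuples_nth[OF assms(1)]
  by (intro nth_equalityI) (auto simp: tuples_def length_merge nth_merge A.m_assoc)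

lemma face_closed:
  assumes "f \<in> tuples A n \<rightarrow> carrier A" "xs \<in> tuples A (Suc n)"
  shows "hochschild_face A n i f xs \<in> carrier A"
  using assms
  by (auto simp: hochschild_face_def tuples_intros intro!: A.m_closed funcset_mem[OF assms(1)] split: nat.split)

text \<open>These are the cosimplicial identities, in the form demanded by
  \<open>alternating_double_sum_zero\<close>. Faces acting at separate places commute up to an index
  shift; where they touch, the identity is associativity in \<open>A\<close>.\<close>

lemma face_face:
  assumes f: "f \<in> tuples A n \<rightarrow> carrier A" and xs: "xs \<in> tuples A (Suc (Suc n))"
    and ij: "i < j" "j \<le> Suc (Suc n)"
  shows "hochschild_face A (Suc n) j (hochschild_face A n i f) xs =
         hochschild_face A (Suc n) i (hochschild_face A n (j - 1) f) xs"
proof -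
  obtain x y zs where xyz: "xs = x # y # zs" "x \<in> carrier A" "y \<in> carrier A" "zs \<in> tuples A n"
    using xs by (auto simp: tuples_Suc)
  have len: "length zs = n" "length xs = Suc (Suc n)" using xs xyz by (auto simp: tuples_def)
  obtain l where j: "j = Suc l" using ij by (cases j) auto
  have fc: "f ys \<in> carrier A" if "ys \<in> tuples A n" for ys using f that by auto
  show ?thesis
  proof (cases i)
    case i: 0
    consider "l = 0" | k where "l = Suc k" "k < n" | "l = Suc n" using ij j by (cases l) (auto simp: le_less)
    then show ?thesis
    proof cases
      case 1
      then show ?thesis
        using xyz fc[OF xyz(4)]
        by (simp add: i j hochschild_face_def merge_def A.m_assoc)
    next
      case (2 k)
      then show ?thesis
        using len by (simp add: i j hochschild_face_def xyz merge_Cons)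
    next
      case 3
      have "f (butlast (y # zs)) \<in> carrier A" "last (y # zs) \<in> carrier A"
        using xyz by (auto intro!: fc tuples_butlast tuples_last simp: tuples_Suc simp del: butlast.simps last.simps)
      then show ?thesis
        using xyz(2) by (simp add: 3 i j hochschild_face_def xyz(1) A.m_assoc)
    qed
  next
    case i: (Suc k)
    consider "l < Suc n" | "l = Suc n" "k < n" | "l = Suc n" "k = n" using ij i j by linarith
    then show ?thesis
    proof cases
      case 1
      then have "k < n" "k < l" using ij i j by auto
      then show ?thesis
        using 1 merge_merge[OF xs, of k l] by (cases l) (simp_all add: i j hochschild_face_def)
    next
      case 2
      then show ?thesis
        using len merge_butlast[of k xs A] by (simp add: i j hochschild_face_def)
    next
      case 3
      have b: "butlast (merge A n xs) = butlast (butlast xs)"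
        using len by (intro nth_equalityI) (auto simp: length_merge nth_merge nth_butlast)
      have ne: "xs \<noteq> []" "butlast xs \<noteq> []" using len by (auto simp flip: length_0_conv)
      have l: "last (merge A n xs) = last (butlast xs) \<otimes> last xs"
        using len ne by (simp add: merge_def last_conv_nth nth_butlast)
      have "f (butlast (butlast xs)) \<in> carrier A" "last (butlast xs) \<in> carrier A" "last xs \<in> carrier A"
        using fc tuples_butlast[OF tuples_butlast[OF xs]] tuples_last[OF tuples_butlast[OF xs]] tuples_last[OF xs]
        by auto
      then show ?thesis
        by (simp add: 3 i j hochschild_face_def b l A.m_assoc)
    qed
  qed
qed

lemma diff_eq_faces:
  assumes f: "f \<in> tuples A n \<rightarrow> carrier A" and xs: "xs \<in> tuples A (Suc n)"
  shows "hochschild_diff A n f xs =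
    (\<Oplus>i\<in>{..Suc n}. signed A i (hochschild_face A n i f xs))"
proof -
  let ?t = "\<lambda>i. signed A i (hochschild_face A n i f xs)"
  have c: "?t i \<in> carrier A" for i using face_closed[OF f xs] by (rule M.signed_closed)
  have "(\<Oplus>i\<in>{1..n}. ?t i) =
    (\<Oplus>i\<in>{1..n}. signed A i (f (take (i - 1) xs @ [xs ! (i - 1) \<otimes> xs ! i] @ drop (i + 1) xs)))"
  proof (rule M.finsum_cong')
    show "?t i = signed A i (f (take (i - 1) xs @ [xs ! (i - 1) \<otimes> xs ! i] @ drop (i + 1) xs))"
      if "i \<in> {1..n}" for i
      using that by (cases i) (auto simp: hochschild_face_def merge_def)
    then show "(\<lambda>i. signed A i (f (take (i - 1) xs @ [xs ! (i - 1) \<otimes> xs ! i] @ drop (i + 1) xs)))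
      \<in> {1..n} \<rightarrow> carrier A" using c by (metis (no_types, lifting) Pi_I)
  qed simp
  moreover have "(\<Oplus>i\<in>{..Suc n}. ?t i) = ?t (Suc n) \<oplus> (\<Oplus>i\<in>{..n}. ?t i)"
    using c by (intro M.finsum_Suc) auto
  moreover have "(\<Oplus>i\<in>{..n}. ?t i) = ?t 0 \<oplus> (\<Oplus>i\<in>{1..n}. ?t i)"
  proof -
    have "{..n} = insert 0 {1..n}" by auto
    then show ?thesis using c by (simp add: M.finsum_insert)
  qed
  moreover have "?t 0 = hd xs \<otimes> f (tl xs)" by (simp add: hochschild_face_def signed_def)
  moreover have "?t (Suc n) = signed A (n + 1) (f (butlast xs) \<otimes> last xs)"
    by (simp add: hochschild_face_def)
  moreover have "(\<Oplus>i\<in>{1..n}. ?t i) \<in> carrier A" using c by (intro M.finsum_closed) auto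
  ultimately show ?thesis
    using xs c[of 0] c[of "Suc n"] unfolding hochschild_diff_def by (simp add: M.a_ac)
qed

lemma diff_closed:
  assumes f: "f \<in> tuples A n \<rightarrow> carrier A"
  shows "hochschild_diff A n f \<in> tuples A (Suc n) \<rightarrow>\<^sub>E carrier A"
proof
  fix xs assume "xs \<in> tuples A (Suc n)"
  then show "hochschild_diff A n f xs \<in> carrier A"
    using face_closed[OF f] by (auto simp: diff_eq_faces[OF f] intro!: M.finsum_closed)
qed (simp add: hochschild_diff_def)

lemma mult_signed_right: "\<lbrakk>x \<in> carrier A; y \<in> carrier A\<rbrakk> \<Longrightarrow> x \<otimes> signed A i y = signed A i (x \<otimes> y)"
  by (simp add: signed_def A.r_minus)

lemma mult_signed_left: "\<lbrakk>x \<in> carrier A; y \<in> carrier A\<rbrakk> \<Longrightarrow> signed A i x \<otimes> y = signed A i (x \<otimes> y)"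
  by (simp add: signed_def A.l_minus)

text \<open>A face is additive in the cochain, so it passes inside the alternating sum of
  \<open>diff_eq_faces\<close>. This produces the double sum for the square of the
  differential.\<close>

lemma face_diff:
  assumes f: "f \<in> tuples A n \<rightarrow> carrier A" and xs: "xs \<in> tuples A (Suc (Suc n))" and j: "j \<le> Suc (Suc n)"
  shows "hochschild_face A (Suc n) j (hochschild_diff A n f) xs =
    (\<Oplus>i\<in>{..Suc n}. signed A i (hochschild_face A (Suc n) j (hochschild_face A n i f) xs))"
proof -
  have c: "hochschild_face A n i f ys \<in> carrier A" if "ys \<in> tuples A (Suc n)" for i ys
    using face_closed[OF f that] .
  consider "j = 0" | k where "j = Suc k" "k < Suc n" | "j = Suc (Suc n)" using j by (cases j) (auto simp: le_less)
  then show ?thesis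
  proof cases
    case 1
    then show ?thesis
      using xs c tuples_intros[OF xs]
      by (simp add: hochschild_face_def[of A "Suc n"] diff_eq_faces[OF f] A.finsum_rdistr mult_signed_right Pi_def
        del: M.finsum_Suc)
  next
    case (2 k)
    then show ?thesis
      using xs c tuples_intros[OF xs] by (simp add: hochschild_face_def[of A "Suc n"] diff_eq_faces[OF f])
  next
    case 3
    then show ?thesis
      using xs c tuples_intros[OF xs]
      by (simp add: hochschild_face_def[of A "Suc n"] diff_eq_faces[OF f] A.finsum_ldistr mult_signed_left Pi_def
        del: M.finsum_Suc)
  qed
qed

lemma diff_diff:
  assumes f: "f \<in> tuples A n \<rightarrow> carrier A" and xs: "xs \<in> tuples A (Suc (Suc n))"
  shows "hochschild_diff A (Suc n) (hochschild_diff A n f) xs = \<zero>"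
proof -
  have d: "hochschild_diff A n f \<in> tuples A (Suc n) \<rightarrow> carrier A"
    using diff_closed[OF f] by auto
  have ff: "hochschild_face A n i f \<in> tuples A (Suc n) \<rightarrow> carrier A" for i
    using face_closed[OF f] by auto
  have "hochschild_diff A (Suc n) (hochschild_diff A n f) xs =
    (\<Oplus>j\<in>{..Suc (Suc n)}. signed A j (\<Oplus>i\<in>{..Suc n}. signed A i
       (hochschild_face A (Suc n) j (hochschild_face A n i f) xs)))"
    using face_closed[OF ff xs]
    unfolding diff_eq_faces[OF d xs]
    by (intro M.finsum_cong') (auto simp: face_diff[OF f xs] intro!: M.finsum_closed M.signed_closed)
  also have "\<dots> = \<zero>"
    using face_closed[OF ff xs] face_face[OF f xs] by (intro M.alternating_double_sum_zero) auto
  finally show ?thesis .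
qed

section \<open>Multilinearity and the cochain spaces\<close>

lemma hom_cong:
  assumes "f \<in> module_hom K A A" "\<And>x. x \<in> carrier A \<Longrightarrow> g x = f x"
  shows "g \<in> module_hom K A A"
  using assms by (auto simp: module_hom_def)

lemma hom_lmult:
  assumes "y \<in> carrier A" "f \<in> module_hom K A A"
  shows "(\<lambda>x. y \<otimes> f x) \<in> module_hom K A A"
  using assms by (auto simp: module_hom_def A.r_distr smult_mult_right Pi_iff)

lemma hom_rmult:
  assumes "y \<in> carrier A" "f \<in> module_hom K A A"
  shows "(\<lambda>x. f x \<otimes> y) \<in> module_hom K A A"
  using assms by (auto simp: module_hom_def A.l_distr smult_mult_left Pi_iff)

lemma hom_comp:
  assumes "f \<in> module_hom K A A" "g \<in> module_hom K A A"
  shows "(\<lambda>x. f (g x)) \<in> module_hom K A A"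
  using assms by (auto simp: module_hom_def Pi_iff)

lemma hom_id: "(\<lambda>x. x) \<in> module_hom K A A"
  by (auto simp: module_hom_def)

lemma hom_zero: "(\<lambda>x. \<zero>) \<in> module_hom K A A"
  by (auto simp: module_hom_def)

lemma hom_add:
  assumes "f \<in> module_hom K A A" "g \<in> module_hom K A A"
  shows "(\<lambda>x. f x \<oplus> g x) \<in> module_hom K A A"
  using assms by (auto simp: module_hom_def Pi_iff M.a_ac smult_r_distr)

lemma hom_smult:
  assumes "c \<in> carrier K" "f \<in> module_hom K A A"
  shows "(\<lambda>x. c \<odot> f x) \<in> module_hom K A A"
  using assms by (auto simp: module_hom_def Pi_iff smult_r_distr smult_assoc1[symmetric] R.m_comm)

lemma smult_signed: "\<lbrakk>c \<in> carrier K; x \<in> carrier A\<rbrakk> \<Longrightarrow> c \<odot> signed A i x = signed A i (c \<odot> x)"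
  by (simp add: signed_def smult_r_minus)

lemma hom_signed:
  assumes "f \<in> module_hom K A A"
  shows "(\<lambda>x. signed A i (f x)) \<in> module_hom K A A"
  using assms by (auto simp: module_hom_def Pi_iff M.signed_add smult_signed)

lemma hom_finsum:
  assumes "finite I" "\<And>i. i \<in> I \<Longrightarrow> f i \<in> module_hom K A A"
  shows "(\<lambda>x. \<Oplus>i\<in>I. f i x) \<in> module_hom K A A"
  using assms
proof (induction I rule: finite_induct)
  case empty
  then show ?case by (simp add: hom_zero)
next
  case (insert j I)
  have "(\<lambda>x. f j x \<oplus> (\<Oplus>i\<in>I. f i x)) \<in> module_hom K A A"
    using insert by (intro hom_add) auto
  then show ?case
    by (rule hom_cong) (use insert in \<open>auto simp: module_hom_def Pi_iff intro!: M.finsum_insert\<close>)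
qed

lemma cochain_iff:
  "f \<in> carrier (hochschild_cochains K A n) \<longleftrightarrow>
    f \<in> extensional (tuples A n) \<and> (\<forall>xs \<in> tuples A n. f xs \<in> carrier A) \<and>
    (\<forall>xs \<in> tuples A n. \<forall>i<n. (\<lambda>x. f (xs[i := x])) \<in> module_hom K A A)"
  by (auto simp: hochschild_cochains_def PiE_def)

lemma cochain_closed:
  "f \<in> carrier (hochschild_cochains K A n) \<Longrightarrow> xs \<in> tuples A n \<Longrightarrow> f xs \<in> carrier A"
  by (simp add: cochain_iff)

lemma cochain_funcset: "f \<in> carrier (hochschild_cochains K A n) \<Longrightarrow> f \<in> tuples A n \<rightarrow> carrier A"
  by (simp add: cochain_iff)

lemma cochain_slot:
  "f \<in> carrier (hochschild_cochains K A n) \<Longrightarrow> xs \<in> tuples A n \<Longrightarrow> i < n \<Longrightarrow>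
    (\<lambda>x. f (xs[i := x])) \<in> module_hom K A A"
  by (simp add: cochain_iff)

lemma cochain_eqI:
  assumes "f \<in> carrier (hochschild_cochains K A n)" "g \<in> carrier (hochschild_cochains K A n)"
    and "\<And>xs. xs \<in> tuples A n \<Longrightarrow> f xs = g xs"
  shows "f = g"
  using assms by (auto simp: cochain_iff intro: extensionalityI)

lemma cochains_simps:
  "xs \<in> tuples A n \<Longrightarrow> (f \<oplus>\<^bsub>hochschild_cochains K A n\<^esub> g) xs = f xs \<oplus> g xs"
  "xs \<in> tuples A n \<Longrightarrow> (c \<odot>\<^bsub>hochschild_cochains K A n\<^esub> f) xs = c \<odot> f xs"
  "xs \<in> tuples A n \<Longrightarrow> \<zero>\<^bsub>hochschild_cochains K A n\<^esub> xs = \<zero>"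
  by (simp_all add: hochschild_cochains_def)

lemma cochain_add:
  assumes "f \<in> carrier (hochschild_cochains K A n)" "g \<in> carrier (hochschild_cochains K A n)"
  shows "f \<oplus>\<^bsub>hochschild_cochains K A n\<^esub> g \<in> carrier (hochschild_cochains K A n)"
  unfolding cochain_iff
proof (intro conjI ballI allI impI)
  fix xs i assume xs: "xs \<in> tuples A n" "i < n"
  show "(\<lambda>x. (f \<oplus>\<^bsub>hochschild_cochains K A n\<^esub> g) (xs[i := x])) \<in> module_hom K A A"
    by (rule hom_cong[OF hom_add[OF cochain_slot[OF assms(1) xs] cochain_slot[OF assms(2) xs]]])
       (simp add: cochains_simps tuples_update xs)
next
  show "f \<oplus>\<^bsub>hochschild_cochains K A n\<^esub> g \<in> extensional (tuples A n)"
    by (simp add: hochschild_cochains_def)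
qed (use assms in \<open>auto simp: cochains_simps cochain_closed\<close>)

lemma cochain_smult:
  assumes "c \<in> carrier K" "f \<in> carrier (hochschild_cochains K A n)"
  shows "c \<odot>\<^bsub>hochschild_cochains K A n\<^esub> f \<in> carrier (hochschild_cochains K A n)"
  unfolding cochain_iff
proof (intro conjI ballI allI impI)
  fix xs i assume xs: "xs \<in> tuples A n" "i < n"
  show "(\<lambda>x. (c \<odot>\<^bsub>hochschild_cochains K A n\<^esub> f) (xs[i := x])) \<in> module_hom K A A"
    by (rule hom_cong[OF hom_smult[OF assms(1) cochain_slot[OF assms(2) xs]]])
       (simp add: cochains_simps tuples_update xs)
next
  show "c \<odot>\<^bsub>hochschild_cochains K A n\<^esub> f \<in> extensional (tuples A n)"
    by (simp add: hochschild_cochains_def)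
qed (use assms in \<open>auto simp: cochains_simps cochain_closed\<close>)

lemma cochain_zero: "\<zero>\<^bsub>hochschild_cochains K A n\<^esub> \<in> carrier (hochschild_cochains K A n)"
  unfolding cochain_iff
proof (intro conjI ballI allI impI)
  fix xs i assume xs: "xs \<in> tuples A n" "i < n"
  show "(\<lambda>x. \<zero>\<^bsub>hochschild_cochains K A n\<^esub> (xs[i := x])) \<in> module_hom K A A"
    by (rule hom_cong[OF hom_zero]) (simp add: cochains_simps tuples_update xs)
next
  show "\<zero>\<^bsub>hochschild_cochains K A n\<^esub> \<in> extensional (tuples A n)"
    by (simp add: hochschild_cochains_def)
qed (auto simp: cochains_simps)

lemma cochains_vectorspace: "vectorspace K (hochschild_cochains K A n)"
proof -
  let ?C = "hochschild_cochains K A n"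
  have "abelian_group ?C"
  proof (rule abelian_groupI)
    fix f assume f: "f \<in> carrier ?C"
    let ?g = "(\<ominus>\<^bsub>K\<^esub> \<one>\<^bsub>K\<^esub>) \<odot>\<^bsub>?C\<^esub> f"
    have g: "?g \<in> carrier ?C" using f by (intro cochain_smult) auto
    have "?g \<oplus>\<^bsub>?C\<^esub> f = \<zero>\<^bsub>?C\<^esub>"
      using f g
      by (intro cochain_eqI[of _ n] cochain_add cochain_zero)
         (auto simp: cochains_simps cochain_closed smult_minus_1 M.l_neg)
    then show "\<exists>g \<in> carrier ?C. g \<oplus>\<^bsub>?C\<^esub> f = \<zero>\<^bsub>?C\<^esub>" using g by blast
  next
    fix f g assume "f \<in> carrier ?C" "g \<in> carrier ?C"
    then show "f \<oplus>\<^bsub>?C\<^esub> g = g \<oplus>\<^bsub>?C\<^esub> f"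
      by (intro cochain_eqI[of _ n] cochain_add) (auto simp: cochains_simps cochain_closed M.a_comm)
  next
    fix f g h assume "f \<in> carrier ?C" "g \<in> carrier ?C" "h \<in> carrier ?C"
    then show "f \<oplus>\<^bsub>?C\<^esub> g \<oplus>\<^bsub>?C\<^esub> h = f \<oplus>\<^bsub>?C\<^esub> (g \<oplus>\<^bsub>?C\<^esub> h)"
      by (intro cochain_eqI[of _ n] cochain_add) (auto simp: cochains_simps cochain_closed M.a_assoc)
  next
    fix f assume "f \<in> carrier ?C"
    then show "\<zero>\<^bsub>?C\<^esub> \<oplus>\<^bsub>?C\<^esub> f = f"
      by (intro cochain_eqI[of _ n] cochain_add cochain_zero) (auto simp: cochains_simps cochain_closed)
  qed (auto simp: cochain_add cochain_zero)
  then have "module K ?C"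
  proof (intro moduleI)
    fix a b f assume "a \<in> carrier K" "b \<in> carrier K" "f \<in> carrier ?C"
    then show "(a \<oplus>\<^bsub>K\<^esub> b) \<odot>\<^bsub>?C\<^esub> f = a \<odot>\<^bsub>?C\<^esub> f \<oplus>\<^bsub>?C\<^esub> b \<odot>\<^bsub>?C\<^esub> f"
      by (intro cochain_eqI[of _ n] cochain_add cochain_smult)
         (auto simp: cochains_simps cochain_closed smult_l_distr)
  next
    fix a b f assume "a \<in> carrier K" "b \<in> carrier K" "f \<in> carrier ?C"
    then show "(a \<otimes>\<^bsub>K\<^esub> b) \<odot>\<^bsub>?C\<^esub> f = a \<odot>\<^bsub>?C\<^esub> (b \<odot>\<^bsub>?C\<^esub> f)"
      by (intro cochain_eqI[of _ n] cochain_add cochain_smult)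
         (auto simp: cochains_simps cochain_closed smult_assoc1)
  next
    fix a f g assume "a \<in> carrier K" "f \<in> carrier ?C" "g \<in> carrier ?C"
    then show "a \<odot>\<^bsub>?C\<^esub> (f \<oplus>\<^bsub>?C\<^esub> g) = a \<odot>\<^bsub>?C\<^esub> f \<oplus>\<^bsub>?C\<^esub> a \<odot>\<^bsub>?C\<^esub> g"
      by (intro cochain_eqI[of _ n] cochain_add cochain_smult)
         (auto simp: cochains_simps cochain_closed smult_r_distr)
  next
    fix f assume "f \<in> carrier ?C"
    then show "\<one>\<^bsub>K\<^esub> \<odot>\<^bsub>?C\<^esub> f = f"
      by (intro cochain_eqI[of _ n] cochain_smult) (auto simp: cochains_simps cochain_closed)
  qed (auto simp: cochain_smult R.cring_axioms)
  then show ?thesis by (simp add: vectorspace_def field_axioms)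
qed

text \<open>In each single slot a face is \<open>f\<close> in one slot, preceded or followed by a
  multiplication, or, at the two outer factors, a multiplication by a fixed value of
  \<open>f\<close>. The cases locate the slot relative to the place where the face
  multiplies.\<close>

lemma face_slot:
  assumes f: "f \<in> carrier (hochschild_cochains K A n)" and xs: "xs \<in> tuples A (Suc n)"
    and k: "k < Suc n"
  shows "(\<lambda>x. hochschild_face A n i f (xs[k := x])) \<in> module_hom K A A"
proof -
  have len: "length xs = Suc n" "xs \<noteq> []" using xs by (auto simp: tuples_def)
  note fc = cochain_closed[OF f] and sl = cochain_slot[OF f]
  show ?thesis
  proof (cases i)
    case i: 0
    show ?thesis
    proof (cases k)
      case 0
      then show ?thesis
        using len hom_rmult[OF fc[OF tuples_tl[OF xs]] hom_id]
        by (cases xs) (auto simp: i hochschild_face_def)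
    next
      case (Suc l)
      then show ?thesis
        using k len hom_lmult[OF tuples_hd[OF xs] sl[OF tuples_tl[OF xs], of l]]
        by (cases xs) (auto simp: i hochschild_face_def)
    qed
  next
    case i: (Suc p)
    show ?thesis
    proof (cases "p < n")
      case p: True
      note m = sl[OF tuples_merge[OF xs p]]
      have pc: "xs ! p \<in> carrier A" "xs ! Suc p \<in> carrier A" using p tuples_nth[OF xs] by auto
      consider "k < p" | "k = p" | "k = Suc p" | "Suc p < k" by linarith
      then show ?thesis
      proof cases
        case 1
        then show ?thesis using m[of k] p k len by (simp add: i hochschild_face_def merge_update)
      next
        case 2
        then show ?thesis
          using hom_comp[OF m[of p] hom_rmult[OF pc(2) hom_id]] p len
          by (simp add: i hochschild_face_def merge_update)
      next
        case 3
        then show ?thesis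
          using hom_comp[OF m[of p] hom_lmult[OF pc(1) hom_id]] p len
          by (simp add: i hochschild_face_def merge_update)
      next
        case 4
        then show ?thesis using m[of "k - 1"] p k len by (simp add: i hochschild_face_def merge_update)
      qed
    next
      case False
      show ?thesis
      proof (cases "k = n")
        case True
        then show ?thesis
          using False len hom_lmult[OF fc[OF tuples_butlast[OF xs]] hom_id]
          by (simp add: i hochschild_face_def butlast_list_update last_list_update)
      next
        case kn: False
        then show ?thesis
          using False k len hom_rmult[OF tuples_last[OF xs] sl[OF tuples_butlast[OF xs], of k]]
          by (simp add: i hochschild_face_def butlast_list_update last_list_update)
      qed
    qed
  qed
qed

lemma diff_cochain:
  assumes f: "f \<in> carrier (hochschild_cochains K A n)"
  shows "hochschild_diff A n f \<in> carrier (hochschild_cochains K A (Suc n))"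
  unfolding cochain_iff
proof (intro conjI ballI allI impI)
  fix xs k assume xs: "xs \<in> tuples A (Suc n)" "k < Suc n"
  have "(\<lambda>x. \<Oplus>i\<in>{..Suc n}. signed A i (hochschild_face A n i f (xs[k := x]))) \<in> module_hom K A A"
    using face_slot[OF f xs] by (intro hom_finsum hom_signed) auto
  then show "(\<lambda>x. hochschild_diff A n f (xs[k := x])) \<in> module_hom K A A"
    by (rule hom_cong) (simp add: diff_eq_faces[OF cochain_funcset[OF f]] tuples_update xs)
qed (use diff_closed[OF cochain_funcset[OF f]] in \<open>auto simp: PiE_def\<close>)

lemma face_add:
  assumes "f \<in> carrier (hochschild_cochains K A n)" "g \<in> carrier (hochschild_cochains K A n)"
    and xs: "xs \<in> tuples A (Suc n)"
  shows "hochschild_face A n i (f \<oplus>\<^bsub>hochschild_cochains K A n\<^esub> g) xs =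
    hochschild_face A n i f xs \<oplus> hochschild_face A n i g xs"
  using tuples_intros[OF xs] assms
  by (auto simp: hochschild_face_def cochains_simps cochain_closed A.r_distr A.l_distr split: nat.split)

lemma face_smult:
  assumes "c \<in> carrier K" "f \<in> carrier (hochschild_cochains K A n)"
    and xs: "xs \<in> tuples A (Suc n)"
  shows "hochschild_face A n i (c \<odot>\<^bsub>hochschild_cochains K A n\<^esub> f) xs =
    c \<odot> hochschild_face A n i f xs"
  using tuples_intros[OF xs] assms
  by (auto simp: hochschild_face_def cochains_simps cochain_closed smult_mult_left smult_mult_right
      split: nat.split)

lemma diff_hom:
  "hochschild_diff A n \<in> module_hom K (hochschild_cochains K A n) (hochschild_cochains K A (Suc n))"
proof -
  let ?C = "hochschild_cochains K A n" and ?D = "hochschild_cochains K A (Suc n)"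
  have fc: "hochschild_face A n i f xs \<in> carrier A"
    if "f \<in> carrier ?C" "xs \<in> tuples A (Suc n)" for f xs i
    using face_closed[OF cochain_funcset[OF that(1)] that(2)] .
  have "hochschild_diff A n (f \<oplus>\<^bsub>?C\<^esub> g) = hochschild_diff A n f \<oplus>\<^bsub>?D\<^esub> hochschild_diff A n g"
    if fg: "f \<in> carrier ?C" "g \<in> carrier ?C" for f g
  proof (rule cochain_eqI)
    fix xs assume xs: "xs \<in> tuples A (Suc n)"
    have "hochschild_diff A n (f \<oplus>\<^bsub>?C\<^esub> g) xs =
      (\<Oplus>i\<in>{..Suc n}. signed A i (hochschild_face A n i f xs) \<oplus> signed A i (hochschild_face A n i g xs))"
      using fc[OF fg(1) xs] fc[OF fg(2) xs]
      by (simp add: diff_eq_faces[OF cochain_funcset[OF cochain_add[OF fg]] xs] face_add[OF fg xs]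
          M.signed_add)
    also have "\<dots> = hochschild_diff A n f xs \<oplus> hochschild_diff A n g xs"
      using fc[OF fg(1) xs] fc[OF fg(2) xs]
      unfolding diff_eq_faces[OF cochain_funcset[OF fg(1)] xs] diff_eq_faces[OF cochain_funcset[OF fg(2)] xs]
      by (intro M.finsum_addf) auto
    finally show "hochschild_diff A n (f \<oplus>\<^bsub>?C\<^esub> g) xs = (hochschild_diff A n f \<oplus>\<^bsub>?D\<^esub> hochschild_diff A n g) xs"
      by (simp add: cochains_simps xs)
  qed (use fg in \<open>auto simp: diff_cochain cochain_add\<close>)
  moreover have "hochschild_diff A n (c \<odot>\<^bsub>?C\<^esub> f) = c \<odot>\<^bsub>?D\<^esub> hochschild_diff A n f"
    if cf: "c \<in> carrier K" "f \<in> carrier ?C" for c f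
  proof (rule cochain_eqI)
    fix xs assume xs: "xs \<in> tuples A (Suc n)"
    have "hochschild_diff A n (c \<odot>\<^bsub>?C\<^esub> f) xs =
      (\<Oplus>i\<in>{..Suc n}. c \<odot> signed A i (hochschild_face A n i f xs))"
      using fc[OF cf(2) xs] cf(1)
      by (simp add: diff_eq_faces[OF cochain_funcset[OF cochain_smult[OF cf]] xs] face_smult[OF cf xs]
          smult_signed)
    also have "\<dots> = c \<odot> hochschild_diff A n f xs"
      using fc[OF cf(2) xs] cf(1)
      unfolding diff_eq_faces[OF cochain_funcset[OF cf(2)] xs]
      by (intro finsum_smult_ldistr[symmetric]) auto
    finally show "hochschild_diff A n (c \<odot>\<^bsub>?C\<^esub> f) xs = (c \<odot>\<^bsub>?D\<^esub> hochschild_diff A n f) xs"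
      by (simp add: cochains_simps xs)
  qed (use cf in \<open>auto simp: diff_cochain cochain_smult\<close>)
  ultimately show ?thesis by (auto simp: module_hom_def diff_cochain)
qed

lemma diff_linear_map:
  "linear_map K (hochschild_cochains K A n) (hochschild_cochains K A (Suc n)) (hochschild_diff A n)"
  using cochains_vectorspace[of n] cochains_vectorspace[of "Suc n"] diff_hom[of n]
  by (auto simp: linear_map_def mod_hom_def mod_hom_axioms_def vectorspace_def)

lemma cocycles_submodule:
  "submodule K (hochschild_cocycles K A n) (hochschild_cochains K A n)"
proof -
  interpret d: linear_map K "hochschild_cochains K A n" "hochschild_cochains K A (Suc n)"
    "hochschild_diff A n" by (rule diff_linear_map)
  have "hochschild_cocycles K A n = d.ker"
    by (auto simp: hochschild_cocycles_def d.ker_def)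
  then show ?thesis using d.ker_is_submodule by simp
qed

lemma cocycles_vectorspace:
  "vectorspace K ((hochschild_cochains K A n)\<lparr>carrier := hochschild_cocycles K A n\<rparr>)"
  by (intro vectorspace.submodule_vectorspace cochains_vectorspace cocycles_submodule)

text \<open>This inclusion is what makes \<open>HH\<close> a quotient of a vector space by a
  subspace, so that its dimension makes sense.\<close>

lemma coboundaries_subset: "hochschild_coboundaries K A n \<subseteq> hochschild_cocycles K A n"
proof (cases n)
  case 0
  then show ?thesis using submodule.zero_closed[OF cocycles_submodule] by simp
next
  case (Suc m)
  have "hochschild_diff A (Suc m) (hochschild_diff A m f) = \<zero>\<^bsub>hochschild_cochains K A (Suc (Suc m))\<^esub>"
    if f: "f \<in> carrier (hochschild_cochains K A m)" for f
    by (rule cochain_eqI[of _ "Suc (Suc m)"])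
       (auto simp: diff_cochain cochain_zero f cochains_simps diff_diff cochain_funcset[OF f])
  then show ?thesis by (auto simp: Suc hochschild_cocycles_def diff_cochain)
qed

lemma coboundaries_submodule:
  "submodule K (hochschild_coboundaries K A n)
    ((hochschild_cochains K A n)\<lparr>carrier := hochschild_cocycles K A n\<rparr>)"
proof -
  have "submodule K (hochschild_coboundaries K A n) (hochschild_cochains K A n)"
  proof (cases n)
    case 0
    interpret C: vectorspace K "hochschild_cochains K A 0" by (rule cochains_vectorspace)
    show ?thesis using C.module_axioms by (simp add: 0 submodule_def)
  next
    case (Suc m)
    interpret d: linear_map K "hochschild_cochains K A m" "hochschild_cochains K A (Suc m)"
      "hochschild_diff A m" by (rule diff_linear_map)
    show ?thesis using d.im_is_submodule by (simp add: d.im_def Suc)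
  qed
  then show ?thesis
    using coboundaries_subset[of n] vectorspace.axioms(1)[OF cocycles_vectorspace[of n]]
    by (auto simp: submodule_def)
qed

text \<open>The entries are released from \<open>S\<close> one at a time, from the left: after
  \<open>k\<close> steps only the entries from position \<open>k\<close> on are still required to
  lie in \<open>S\<close>. Each step is linearity in a single slot.\<close>

lemma cochain_zero_if_zero_on_generators:
  assumes f: "f \<in> carrier (hochschild_cochains K A n)"
    and S: "S \<subseteq> carrier A" "span S = carrier A"
    and z: "\<And>xs. length xs = n \<Longrightarrow> set xs \<subseteq> S \<Longrightarrow> f xs = \<zero>"
    and xs: "xs \<in> tuples A n"
  shows "f xs = \<zero>"
proof -
  have "\<forall>xs \<in> tuples A n. set (drop k xs) \<subseteq> S \<longrightarrow> f xs = \<zero>" if "k \<le> n" for k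
    using that
  proof (induction k)
    case 0
    then show ?case using z by (auto simp: tuples_def)
  next
    case (Suc k)
    show ?case
    proof (intro ballI impI)
      fix xs assume xs: "xs \<in> tuples A n" "set (drop (Suc k) xs) \<subseteq> S"
      have k: "k < n" "length xs = n" using Suc.prems xs by (auto simp: tuples_def)
      have "f (xs[k := xs ! k]) = \<zero>"
      proof (rule module_hom_eq_on_span[OF _ cochain_slot[OF f xs(1) k(1)] S(1)])
        show "xs ! k \<in> span S" using S(2) tuples_nth[OF xs(1) k(1)] by simp
        fix s assume s: "s \<in> S"
        have "drop k (xs[k := s]) = s # drop (Suc k) xs"
          using k by (simp add: Cons_nth_drop_Suc[symmetric])
        then have "set (drop k (xs[k := s])) \<subseteq> S" using s xs(2) by simp
        then show "f (xs[k := s]) = \<zero>" using Suc s S tuples_update[OF xs(1)] by auto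
      qed (rule module_axioms)
      then show "f xs = \<zero>" by simp
    qed
  qed
  from this[of n] xs show ?thesis by (auto simp: tuples_def)
qed

text \<open>Evaluating a cochain at a tuple of generators and then applying some \<phi> gives
  finitely many functionals. They separate the cocycles, because a multilinear map is determined by
  its values on generators.\<close>

theorem HH_fin_dim_if_separated:
  assumes "finite \<Phi>" "\<And>\<phi>. \<phi> \<in> \<Phi> \<Longrightarrow> linear_functional K A \<phi>"
    and sep: "\<And>x. x \<in> carrier A \<Longrightarrow> (\<And>\<phi>. \<phi> \<in> \<Phi> \<Longrightarrow> \<phi> x = \<zero>\<^bsub>K\<^esub>) \<Longrightarrow> x = \<zero>"
  shows "vectorspace.fin_dim K (HH K A n)"
proof -
  let ?Z = "(hochschild_cochains K A n)\<lparr>carrier := hochschild_cocycles K A n\<rparr>"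
  interpret Z: vectorspace K ?Z by (rule cocycles_vectorspace)
  obtain S where S: "finite S" "S \<subseteq> carrier A" "span S = carrier A"
    using fin_dim_if_separated[OF assms] unfolding fin_dim_def by blast
  define L where "L = {xs. set xs \<subseteq> S \<and> length xs = n}"
  have L: "L \<subseteq> tuples A n" using S(2) by (auto simp: L_def tuples_def)
  have C: "f \<in> carrier (hochschild_cochains K A n)" if "f \<in> carrier ?Z" for f
    using that by (auto simp: hochschild_cocycles_def)
  have "Z.fin_dim"
  proof (rule Z.fin_dim_if_separated)
    show "finite ((\<lambda>(\<phi>, xs) f. \<phi> (f xs)) ` (\<Phi> \<times> L))"
      using assms(1) finite_lists_length_eq[OF S(1), of n] by (auto simp: L_def)
  next
    fix \<psi> assume "\<psi> \<in> (\<lambda>(\<phi>, xs) f. \<phi> (f xs)) ` (\<Phi> \<times> L)"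
    then obtain \<phi> xs where \<psi>: "\<psi> = (\<lambda>f. \<phi> (f xs))" "\<phi> \<in> \<Phi>" "xs \<in> L" by auto
    have xs: "xs \<in> tuples A n" using \<psi> L by auto
    show "linear_functional K ?Z \<psi>"
      using linear_functionalD[OF assms(2)[OF \<psi>(2)]] cochain_closed[OF C xs]
      by (auto simp: linear_functional_def \<psi>(1) cochains_simps xs)
  next
    fix f assume f: "f \<in> carrier ?Z" "\<And>\<psi>. \<psi> \<in> (\<lambda>(\<phi>, xs) f. \<phi> (f xs)) ` (\<Phi> \<times> L) \<Longrightarrow> \<psi> f = \<zero>\<^bsub>K\<^esub>"
    have "f xs = \<zero>" if "xs \<in> L" for xs
      using f(2) that L cochain_closed[OF C[OF f(1)]] by (intro sep) force+
    then have "f xs = \<zero>" if "xs \<in> tuples A n" for xs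
      using cochain_zero_if_zero_on_generators[OF C[OF f(1)] S(2,3) _ that] by (auto simp: L_def)
    then have "f = \<zero>\<^bsub>hochschild_cochains K A n\<^esub>"
      using C[OF f(1)] cochain_zero by (intro cochain_eqI[of _ n]) (auto simp: cochains_simps)
    then show "f = \<zero>\<^bsub>?Z\<^esub>" by simp
  qed
  then show ?thesis unfolding HH_def by (rule Z.quotient_fin_dim) (rule coboundaries_submodule)
qed

section \<open>Infinite dimension in degrees 0 and 1\<close>

lemma diff_0:
  assumes "f \<in> carrier (hochschild_cochains K A 0)" "x \<in> carrier A"
  shows "hochschild_diff A 0 f [x] = x \<otimes> f [] \<ominus> f [] \<otimes> x"
  using assms cochain_closed[OF assms(1), of "[]"]
  by (simp add: hochschild_diff_def tuples_def signed_def a_minus_def)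

lemma diff_1:
  assumes "f \<in> carrier (hochschild_cochains K A 1)" "x \<in> carrier A" "y \<in> carrier A"
  shows "hochschild_diff A 1 f [x, y] = x \<otimes> f [y] \<ominus> f [x \<otimes> y] \<oplus> f [x] \<otimes> y"
  using assms cochain_closed[OF assms(1)]
  by (simp add: hochschild_diff_def tuples_def signed_def a_minus_def)

text \<open>A cochain of degree 0 is an element stored as its value at the empty list, and its
  differential is the commutator with that element. Central elements are therefore cocycles, and the
  only coboundary is zero.\<close>

theorem HH_0_not_fin_dim:
  assumes \<psi>: "\<And>n::nat. linear_functional K A (\<psi> n)"
    and ev: "\<And>x. x \<in> carrier A \<Longrightarrow> \<exists>n0. \<forall>n\<ge>n0. \<psi> n x = \<zero>\<^bsub>K\<^esub>"
    and z: "\<And>n. z n \<in> carrier A" "\<And>n. \<psi> n (z n) \<noteq> \<zero>\<^bsub>K\<^esub>"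
    and central: "\<And>n x. x \<in> carrier A \<Longrightarrow> z n \<otimes> x = x \<otimes> z n"
  shows "\<not> vectorspace.fin_dim K (HH K A 0)"
proof -
  let ?Z = "(hochschild_cochains K A 0)\<lparr>carrier := hochschild_cocycles K A 0\<rparr>"
  have C: "f [] \<in> carrier A" if "f \<in> carrier ?Z" for f
    using that cochain_closed[of f 0 "[]"] by (auto simp: hochschild_cocycles_def tuples_0)
  have zn: "(\<lambda>xs \<in> tuples A 0. z n) \<in> carrier ?Z" for n
  proof -
    have c: "(\<lambda>xs \<in> tuples A 0. z n) \<in> carrier (hochschild_cochains K A 0)"
      using z(1) by (simp add: cochain_iff)
    have "hochschild_diff A 0 (\<lambda>xs \<in> tuples A 0. z n) [x] = \<zero>" if "x \<in> carrier A" for x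
      using diff_0[OF c that] that z(1) central by (simp add: tuples_0 a_minus_def M.r_neg)
    then have "hochschild_diff A 0 (\<lambda>xs \<in> tuples A 0. z n) = \<zero>\<^bsub>hochschild_cochains K A (Suc 0)\<^esub>"
      using diff_cochain[OF c]
      by (intro cochain_eqI[of _ "Suc 0"])
         (auto simp: cochain_zero cochains_simps tuples_Suc[of _ A 0] tuples_0[of A]
           simp del: restrict_apply)
    then show ?thesis using c by (simp add: hochschild_cocycles_def)
  qed
  show ?thesis unfolding HH_def
  proof (rule vectorspace.quotient_not_fin_dim[OF cocycles_vectorspace coboundaries_submodule,
        where \<psi> = "\<lambda>n f. \<psi> n (f [])"])
    show "linear_functional K ?Z (\<lambda>f. \<psi> n (f []))" for n
      using linear_functionalD[OF \<psi>] C by (auto simp: linear_functional_def cochains_simps tuples_0)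
    show "\<psi> n (f []) = \<zero>\<^bsub>K\<^esub>" if "f \<in> hochschild_coboundaries K A 0" for n f
      using that linear_functional_zero[OF \<psi>] by (simp add: cochains_simps tuples_0)
    show "\<exists>n0. \<forall>n\<ge>n0. \<psi> n (f []) = \<zero>\<^bsub>K\<^esub>" if "f \<in> carrier ?Z" for f
      using ev C[OF that] by blast
    show "\<exists>f \<in> carrier ?Z. \<psi> n (f []) \<noteq> \<zero>\<^bsub>K\<^esub>" for n
      using zn[of n] z(2)[of n] by (intro bexI) (auto simp: tuples_0)
  qed
qed

text \<open>For central \<open>z n\<close> the maps \<open>x \<mapsto> z n \<cdot> E x\<close> are derivations; as inner derivations kill the
  central element \<open>w\<close>, evaluation at \<open>w\<close> is defined on \<open>HH\<^sup>1\<close>.\<close>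

theorem HH_1_not_fin_dim:
  assumes \<psi>: "\<And>n::nat. linear_functional K A (\<psi> n)"
    and ev: "\<And>x. x \<in> carrier A \<Longrightarrow> \<exists>n0. \<forall>n\<ge>n0. \<psi> n x = \<zero>\<^bsub>K\<^esub>"
    and z: "\<And>n. z n \<in> carrier A" "\<And>n x. x \<in> carrier A \<Longrightarrow> z n \<otimes> x = x \<otimes> z n"
    and w: "w \<in> carrier A" "\<And>x. x \<in> carrier A \<Longrightarrow> w \<otimes> x = x \<otimes> w"
    and E: "E \<in> module_hom K A A"
      "\<And>x y. x \<in> carrier A \<Longrightarrow> y \<in> carrier A \<Longrightarrow> E (x \<otimes> y) = E x \<otimes> y \<oplus> x \<otimes> E y"
    and nz: "\<And>n. \<psi> n (z n \<otimes> E w) \<noteq> \<zero>\<^bsub>K\<^esub>"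
  shows "\<not> vectorspace.fin_dim K (HH K A 1)"
proof -
  let ?Z = "(hochschild_cochains K A 1)\<lparr>carrier := hochschild_cocycles K A 1\<rparr>"
  have w1: "[w] \<in> tuples A 1" using w by (simp add: tuples_def)
  have C: "f [w] \<in> carrier A" if "f \<in> carrier ?Z" for f
    using that cochain_closed[OF _ w1] by (auto simp: hochschild_cocycles_def)
  have Ec: "E x \<in> carrier A" if "x \<in> carrier A" for x
    using module_hom_closed[OF E(1)] that by auto
  define D where "D n = (\<lambda>xs \<in> tuples A 1. z n \<otimes> E (hd xs))" for n
  have D: "D n [x] = z n \<otimes> E x" if "x \<in> carrier A" for n x
    using that by (simp add: D_def tuples_def)
  have Dn: "D n \<in> carrier ?Z" for n
  proof -
    have c: "D n \<in> carrier (hochschild_cochains K A 1)"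
      unfolding cochain_iff
    proof (intro conjI ballI allI impI)
      fix xs i assume xs: "xs \<in> tuples A 1" "i < (1::nat)"
      then obtain y where "xs = [y]" by (auto simp: tuples_Suc tuples_0)
      then show "(\<lambda>x. D n (xs[i := x])) \<in> module_hom K A A"
        using xs by (intro hom_cong[OF hom_lmult[OF z(1)[of n] E(1)]]) (simp add: D)
    qed (auto simp: D_def tuples_Suc tuples_0 z Ec)
    have "hochschild_diff A 1 (D n) [x, y] = \<zero>" if xy: "x \<in> carrier A" "y \<in> carrier A" for x y
    proof -
      \<comment> \<open>The cocycle condition is the Leibniz rule for \<open>z n\<close> times
        \<open>E\<close>; centrality carries \<open>z n\<close> past \<open>x\<close> in the summand
        containing \<open>E y\<close>.\<close>
      have "z n \<otimes> E (x \<otimes> y) = x \<otimes> (z n \<otimes> E y) \<oplus> z n \<otimes> E x \<otimes> y"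
      proof -
        have "z n \<otimes> (x \<otimes> E y) = x \<otimes> (z n \<otimes> E y)"
          using xy z Ec A.m_assoc by metis
        then show ?thesis
          using xy z(1) Ec by (simp add: E(2) A.r_distr M.a_comm A.m_assoc)
      qed
      then have "hochschild_diff A 1 (D n) [x, y] =
        x \<otimes> (z n \<otimes> E y) \<ominus> (x \<otimes> (z n \<otimes> E y) \<oplus> z n \<otimes> E x \<otimes> y) \<oplus> z n \<otimes> E x \<otimes> y"
        unfolding diff_1[OF c xy] using xy by (simp add: D)
      also have "\<dots> = \<zero>"
        using xy z Ec by (simp add: a_minus_def M.minus_add M.a_ac M.r_neg M.r_neg1 M.r_neg2)
      finally show ?thesis .
    qed
    then have "hochschild_diff A 1 (D n) = \<zero>\<^bsub>hochschild_cochains K A (Suc 1)\<^esub>"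
      using diff_cochain[OF c]
      by (intro cochain_eqI[of _ "Suc 1"]) (auto simp: cochain_zero cochains_simps, auto simp: tuples_Suc tuples_0)
    then show ?thesis using c by (simp add: hochschild_cocycles_def)
  qed
  show ?thesis unfolding HH_def
  proof (rule vectorspace.quotient_not_fin_dim[OF cocycles_vectorspace coboundaries_submodule,
        where \<psi> = "\<lambda>n f. \<psi> n (f [w])"])
    show "linear_functional K ?Z (\<lambda>f. \<psi> n (f [w]))" for n
      using linear_functionalD[OF \<psi>] C by (auto simp: linear_functional_def cochains_simps w1 simp del: One_nat_def)
    show "\<psi> n (f [w]) = \<zero>\<^bsub>K\<^esub>" if f: "f \<in> hochschild_coboundaries K A 1" for n f
    proof -
      from f obtain g where g: "g \<in> carrier (hochschild_cochains K A 0)" "f = hochschild_diff A 0 g" by auto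
      then have "f [w] = \<zero>"
        using cochain_closed[OF g(1), of "[]"] w by (simp add: diff_0 tuples_0 a_minus_def M.r_neg)
      then show ?thesis using linear_functional_zero[OF \<psi>] by simp
    qed
    show "\<exists>n0. \<forall>n\<ge>n0. \<psi> n (f [w]) = \<zero>\<^bsub>K\<^esub>" if "f \<in> carrier ?Z" for f
      using ev C[OF that] by blast
    show "\<exists>f \<in> carrier ?Z. \<psi> n (f [w]) \<noteq> \<zero>\<^bsub>K\<^esub>" for n
      using Dn[of n] nz[of n] by (intro bexI[of _ "D n"]) (auto simp: D w)
  qed
qed

end


section \<open>Path algebras modulo quadratic monomial ideals\<close>

lemma (in wf_digraph) mem_quiver_paths_iff:
  "(u, es) \<in> quiver_paths G \<longleftrightarrow> awalk u es (path_target G (u, es))"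
  by (auto simp: quiver_paths_def path_target_def)

lemma (in wf_digraph) quiver_paths_append_iff:
  "(u, xs @ ys) \<in> quiver_paths G \<longleftrightarrow>
    (u, xs) \<in> quiver_paths G \<and> (path_target G (u, xs), ys) \<in> quiver_paths G"
  by (auto simp: mem_quiver_paths_iff path_target_def awlast_append)

lemma (in abelian_monoid) finsum_eq_single:
  assumes "finite S" "i \<in> S" "f i \<in> carrier G" "\<And>j. j \<in> S \<Longrightarrow> j \<noteq> i \<Longrightarrow> f j = \<zero>"
  shows "finsum G f S = f i"
proof -
  have "f j \<in> carrier G" if "j \<in> S" for j using assms(3,4) that by (cases "j = i") auto
  then have "finsum G f S = finsum G (\<lambda>j. if i = j then f j else \<zero>) S"
    using assms(3,4) by (intro finsum_cong') auto
  also have "\<dots> = f i"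
    using assms \<open>\<And>j. j \<in> S \<Longrightarrow> f j \<in> carrier G\<close> by (intro finsum_singleton) auto
  finally show ?thesis .
qed

text \<open>The locale predicate \<open>ideal\<close> includes \<open>ring\<close>, so the ring
  axioms of \<open>P\<close> come with the presentation; the laws of scalar multiplication remain to
  be proved. Gentleness enters later, with the cocomplete cycles.\<close>

locale quiver_quotient = K: field K + wf_digraph Q + P: ideal I "path_algebra K Q"
  for K :: "('k, 'm) ring_scheme" (structure) and Q :: "('v, 'e) pre_digraph" and I +
  assumes generated: "generated_by_paths2 K Q I"
begin

abbreviation "P \<equiv> path_algebra K Q"
abbreviation "A \<equiv> quiver_algebra K Q I"
abbreviation "\<pi> \<equiv> \<lambda>f. I +>\<^bsub>P\<^esub> f"

lemma P_carrier_iff: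
  "f \<in> carrier P \<longleftrightarrow> (\<forall>p \<in> quiver_paths Q. f p \<in> carrier K) \<and>
    (\<forall>p. p \<notin> quiver_paths Q \<longrightarrow> f p = \<zero>) \<and> finite {p. f p \<noteq> \<zero>}"
  by (simp only: path_algebra_def partial_object.select_convs mem_Collect_eq)

lemma P_carrierI:
  assumes "\<And>p. p \<in> quiver_paths Q \<Longrightarrow> f p \<in> carrier K" "\<And>p. p \<notin> quiver_paths Q \<Longrightarrow> f p = \<zero>"
    and "finite {p. f p \<noteq> \<zero>}"
  shows "f \<in> carrier P"
  using assms unfolding P_carrier_iff by blast

lemma P_carrierD:
  assumes "f \<in> carrier P"
  shows "p \<notin> quiver_paths Q \<Longrightarrow> f p = \<zero>" "finite {p. f p \<noteq> \<zero>}"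
  using assms unfolding P_carrier_iff by blast+

lemma P_simps:
  "(f \<oplus>\<^bsub>P\<^esub> g) p = f p \<oplus> g p" "\<zero>\<^bsub>P\<^esub> p = \<zero>" "(c \<odot>\<^bsub>P\<^esub> f) p = c \<otimes> f p"
  by (simp_all add: path_algebra_def)

lemma P_coeff_closed [simp]: "f \<in> carrier P \<Longrightarrow> f p \<in> carrier K"
  unfolding P_carrier_iff by (metis K.zero_closed)

lemma P_finite_supportI:
  assumes "f \<in> carrier P" "\<And>p. f p = \<zero> \<Longrightarrow> g p = \<zero>"
  shows "finite {p. g p \<noteq> \<zero>}"
proof (rule finite_subset)
  show "{p. g p \<noteq> \<zero>} \<subseteq> {p. f p \<noteq> \<zero>}" using assms(2) by blast
  show "finite {p. f p \<noteq> \<zero>}" using assms(1) by (rule P_carrierD)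
qed

text \<open>A factorization of a path is determined by its cut position, so the convolution becomes
  a sum over \<open>{..length es}\<close>. As paths compose from right to left, the right factor
  \<open>g\<close> sees the initial piece.\<close>

lemma P_mult:
  assumes f: "f \<in> carrier P" and g: "g \<in> carrier P" and p: "(u, es) \<in> quiver_paths Q"
  shows "(f \<otimes>\<^bsub>P\<^esub> g) (u, es) =
    (\<Oplus>i\<in>{..length es}. f (path_target Q (u, take i es), drop i es) \<otimes> g (u, take i es))"
proof -
  let ?h = "\<lambda>i. ((path_target Q (u, take i es), drop i es), (u, take i es))"
  let ?S = "{(p, q). p \<in> quiver_paths Q \<and> q \<in> quiver_paths Q \<and> fst p = path_target Q q \<and>
    path_comp p q = (u, es)}"
  have S: "?S = ?h ` {..length es}"
  proof (intro equalityI subsetI)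
    fix pq assume "pq \<in> ?S"
    then obtain a xs ys where "pq = ((a, ys), (u, xs))" "es = xs @ ys" "a = path_target Q (u, xs)"
      by (auto simp: path_comp_def)
    then show "pq \<in> ?h ` {..length es}" by (intro image_eqI[of _ _ "length xs"]) auto
  next
    fix pq assume "pq \<in> ?h ` {..length es}"
    then obtain i where "pq = ?h i" by auto
    then show "pq \<in> ?S"
      using p quiver_paths_append_iff[of u "take i es" "drop i es"] by (auto simp: path_comp_def)
  qed
  have inj: "inj_on ?h {..length es}"
  proof (rule inj_onI)
    fix i j assume ij: "i \<in> {..length es}" "j \<in> {..length es}" "?h i = ?h j"
    then have "length (take i es) = length (take j es)" by simp
    then show "i = j" using ij by simp
  qed
  have "(f \<otimes>\<^bsub>P\<^esub> g) (u, es) = finsum K (\<lambda>(p, q). f p \<otimes> g q) ?S"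
    by (simp only: path_algebra_def monoid.select_convs)
  also have "\<dots> = finsum K (\<lambda>(p, q). f p \<otimes> g q) (?h ` {..length es})"
    by (rule arg_cong[OF S])
  also have "\<dots> = (\<Oplus>i\<in>{..length es}. case ?h i of (p, q) \<Rightarrow> f p \<otimes> g q)"
    by (rule K.finsum_reindex[OF _ inj]) (use f g in auto)
  finally show ?thesis by simp
qed

lemma P_mult_eq_single:
  assumes f: "f \<in> carrier P" and g: "g \<in> carrier P" and p: "(u, xs @ ys) \<in> quiver_paths Q"
    and z: "\<And>xs' ys'. xs' @ ys' = xs @ ys \<Longrightarrow> length xs' \<noteq> length xs \<Longrightarrow>
      f (path_target Q (u, xs'), ys') = \<zero> \<or> g (u, xs') = \<zero>"
  shows "(f \<otimes>\<^bsub>P\<^esub> g) (u, xs @ ys) = f (path_target Q (u, xs), ys) \<otimes> g (u, xs)"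
proof -
  let ?t = "\<lambda>i. f (path_target Q (u, take i (xs @ ys)), drop i (xs @ ys)) \<otimes> g (u, take i (xs @ ys))"
  have "(f \<otimes>\<^bsub>P\<^esub> g) (u, xs @ ys) = ?t (length xs)"
    unfolding P_mult[OF f g p]
  proof (rule K.finsum_eq_single)
    fix i assume i: "i \<in> {..length (xs @ ys)}" "i \<noteq> length xs"
    have "f (path_target Q (u, take i (xs @ ys)), drop i (xs @ ys)) = \<zero> \<or> g (u, take i (xs @ ys)) = \<zero>"
      using i by (intro z append_take_drop_id) auto
    then show "?t i = \<zero>" using f g by auto
  qed (use f g in auto)
  then show ?thesis by simp
qed

lemma P_eqI:
  assumes "f \<in> carrier P" "g \<in> carrier P" "\<And>p. p \<in> quiver_paths Q \<Longrightarrow> f p = g p"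
  shows "f = g"
  using assms by (metis ext P_carrierD(1))

lemma P_smult_closed:
  assumes "c \<in> carrier K" "f \<in> carrier P"
  shows "c \<odot>\<^bsub>P\<^esub> f \<in> carrier P"
proof -
  have "finite {p. c \<otimes> f p \<noteq> \<zero>}"
    using assms by (intro P_finite_supportI[OF assms(2)]) auto
  then show ?thesis
    using assms by (intro P_carrierI) (simp_all add: P_simps P_carrierD(1))
qed

lemma P_vectorspace: "vectorspace K P"
proof -
  have "module K P"
  proof (rule moduleI)
    show "cring K" by (rule K.is_cring)
    show "abelian_group P" by (rule P.is_abelian_group)
  qed (auto simp: P_smult_closed P_simps K.l_distr K.r_distr K.m_assoc)
  then show ?thesis by (simp add: vectorspace_def K.field_axioms)
qed

lemma P_smult_mult:
  assumes c: "c \<in> carrier K" and f: "f \<in> carrier P" and g: "g \<in> carrier P"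
  shows "(c \<odot>\<^bsub>P\<^esub> f) \<otimes>\<^bsub>P\<^esub> g = c \<odot>\<^bsub>P\<^esub> (f \<otimes>\<^bsub>P\<^esub> g)" "f \<otimes>\<^bsub>P\<^esub> (c \<odot>\<^bsub>P\<^esub> g) = c \<odot>\<^bsub>P\<^esub> (f \<otimes>\<^bsub>P\<^esub> g)"
proof -
  show "(c \<odot>\<^bsub>P\<^esub> f) \<otimes>\<^bsub>P\<^esub> g = c \<odot>\<^bsub>P\<^esub> (f \<otimes>\<^bsub>P\<^esub> g)"
  proof (rule P_eqI)
    fix p assume "p \<in> quiver_paths Q"
    then show "((c \<odot>\<^bsub>P\<^esub> f) \<otimes>\<^bsub>P\<^esub> g) p = (c \<odot>\<^bsub>P\<^esub> (f \<otimes>\<^bsub>P\<^esub> g)) p"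
      using assms
      by (cases p) (simp add: P_mult P_smult_closed P_simps K.finsum_rdistr K.m_assoc Pi_def)
  qed (use assms in \<open>auto simp: P_smult_closed\<close>)
  show "f \<otimes>\<^bsub>P\<^esub> (c \<odot>\<^bsub>P\<^esub> g) = c \<odot>\<^bsub>P\<^esub> (f \<otimes>\<^bsub>P\<^esub> g)"
  proof (rule P_eqI)
    fix p assume "p \<in> quiver_paths Q"
    then show "(f \<otimes>\<^bsub>P\<^esub> (c \<odot>\<^bsub>P\<^esub> g)) p = (c \<odot>\<^bsub>P\<^esub> (f \<otimes>\<^bsub>P\<^esub> g)) p"
      using assms
      by (cases p) (simp add: P_mult P_smult_closed P_simps K.finsum_rdistr K.m_lcomm Pi_def)
  qed (use assms in \<open>auto simp: P_smult_closed\<close>)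
qed

lemma path_elem_closed: "p \<in> quiver_paths Q \<Longrightarrow> path_elem K p \<in> carrier P"
  by (intro P_carrierI) (auto simp: path_elem_def)

lemma path_elem_mult:
  assumes "(u, xs @ ys) \<in> quiver_paths Q"
  shows "path_elem K (path_target Q (u, xs), ys) \<otimes>\<^bsub>P\<^esub> path_elem K (u, xs) = path_elem K (u, xs @ ys)"
    (is "?f \<otimes>\<^bsub>P\<^esub> ?g = ?h")
proof -
  have fg: "?f \<in> carrier P" "?g \<in> carrier P" "?h \<in> carrier P"
    using assms by (auto simp: quiver_paths_append_iff intro!: path_elem_closed)
  show ?thesis
  proof (rule P_eqI)
    fix p assume p: "p \<in> quiver_paths Q"
    show "(?f \<otimes>\<^bsub>P\<^esub> ?g) p = ?h p"
    proof (cases "p = (u, xs @ ys)")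
      case True
      have "(?f \<otimes>\<^bsub>P\<^esub> ?g) (u, xs @ ys) = ?f (path_target Q (u, xs), ys) \<otimes> ?g (u, xs)"
        using fg assms by (intro P_mult_eq_single) (auto simp: path_elem_def)
      then show ?thesis by (simp add: True path_elem_def)
    next
      case False
      obtain v es where [simp]: "p = (v, es)" by (cases p)
      have "?f (path_target Q (v, take i es), drop i es) \<otimes> ?g (v, take i es) = \<zero>" for i
        using False append_take_drop_id[of i es] by (auto simp: path_elem_def simp del: append_take_drop_id)
      then show ?thesis
        using p False fg by (simp add: P_mult) (simp add: path_elem_def)
    qed
  qed (use fg in auto)
qed

section \<open>Reduced paths as a basis of the quotient\<close>

definition reduced :: "('v, 'e) path \<Rightarrow> bool" where
  "reduced p \<longleftrightarrow> p \<in> quiver_paths Q \<and>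
    (\<forall>a b. sublist [b, a] (snd p) \<longrightarrow> path_elem K (path2 Q a b) \<notin> I)"

lemma reduced_appendD:
  assumes "reduced (u, xs @ ys)"
  shows "reduced (u, xs)" "reduced (path_target Q (u, xs), ys)"
  using assms by (auto simp: reduced_def quiver_paths_append_iff sublist_append)

lemma not_reduced_in_ideal:
  assumes "p \<in> quiver_paths Q" "\<not> reduced p"
  shows "path_elem K p \<in> I"
proof -
  obtain u xs ys a b where p: "p = (u, xs @ [b, a] @ ys)" and ab: "path_elem K (path2 Q a b) \<in> I"
    using assms by (cases p) (auto simp: reduced_def sublist_def)
  have q: "(u, (xs @ [b, a]) @ ys) \<in> quiver_paths Q" "(u, xs @ [b, a]) \<in> quiver_paths Q"
    "(path_target Q (u, xs @ [b, a]), ys) \<in> quiver_paths Q" "(u, xs) \<in> quiver_paths Q"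
    using assms(1) quiver_paths_append_iff[of u "xs @ [b, a]" ys] quiver_paths_append_iff[of u xs "[b, a]"]
    by (auto simp: p)
  \<comment> \<open>\<open>path2\<close> takes its starting vertex from the arrow \<open>b\<close>;
    it has to be matched with the end of the initial piece \<open>xs\<close> before the two elements
    can be multiplied.\<close>
  have "tail Q b = path_target Q (u, xs)"
    using q(2) by (auto simp: mem_quiver_paths_iff path_target_def awalk_Cons_iff)
  then have "path_elem K (u, xs @ [b, a]) \<in> I"
    using P.I_r_closed[OF ab path_elem_closed[OF q(4)]] path_elem_mult[OF q(2)]
    by (simp add: path2_def)
  then have "path_elem K (path_target Q (u, xs @ [b, a]), ys) \<otimes>\<^bsub>P\<^esub> path_elem K (u, xs @ [b, a]) \<in> I"
    by (intro P.I_l_closed path_elem_closed q)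
  then show ?thesis
    using path_elem_mult[OF q(1)] by (simp add: p)
qed

text \<open>The elements vanishing on reduced paths form an ideal, because both pieces of a cut
  reduced path are reduced. This ideal contains the generators, hence \<open>I\<close>. Conversely,
  its members are linear combinations of nonreduced paths, each of which lies in
  \<open>I\<close>.\<close>

lemma ideal_iff: "f \<in> I \<longleftrightarrow> f \<in> carrier P \<and> (\<forall>p. reduced p \<longrightarrow> f p = \<zero>)"
proof -
  interpret V: vectorspace K P by (rule P_vectorspace)
  define J where "J = {f \<in> carrier P. \<forall>p. reduced p \<longrightarrow> f p = \<zero>}"
  have "submodule K J P"
    by unfold_locales (auto simp: J_def P_simps)
  then have "subgroup J (add_monoid P)"
    by (intro additive_subgroup.a_subgroup V.submodule_add_subgroup)
  moreover have "(f \<otimes>\<^bsub>P\<^esub> g) p = \<zero>"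
    if fg: "f \<in> carrier P" "g \<in> carrier P" "f \<in> J \<or> g \<in> J" and p: "reduced p" for f g p
  proof -
    obtain u es where [simp]: "p = (u, es)" by (cases p)
    have "f (path_target Q (u, take i es), drop i es) \<otimes> g (u, take i es) = \<zero>" for i
      using fg p reduced_appendD[of u "take i es" "drop i es"] by (auto simp: J_def)
    then show ?thesis using fg p by (simp add: P_mult reduced_def)
  qed
  ultimately have J: "ideal J P"
    by (intro idealI P.ring_axioms) (auto simp: J_def)
  obtain R where R: "R \<subseteq> {p \<in> quiver_paths Q. length (snd p) = 2}" "I = genideal P (path_elem K ` R)"
    using generated by (auto simp: generated_by_paths2_def)
  have Rc: "path_elem K ` R \<subseteq> carrier P" using R(1) path_elem_closed by auto
  have "path_elem K p \<in> J" if p: "p \<in> R" for p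
  proof -
    have pI: "path_elem K p \<in> I" using p R(2) P.genideal_self[OF Rc] by auto
    obtain u b a where ba: "p = (u, [b, a])"
      using p R(1) by (cases p) (auto simp: numeral_2_eq_2 length_Suc_conv)
    then have "u = tail Q b" using p R(1) by (auto simp: mem_quiver_paths_iff awalk_Cons_iff)
    then have "\<not> reduced p" using pI by (auto simp: reduced_def ba path2_def)
    then show ?thesis
      using p Rc by (auto simp: J_def path_elem_def)
  qed
  then have "I \<subseteq> J" unfolding R(2) by (intro P.genideal_minimal J) auto
  \<comment> \<open>The finite set bounds the support; the induction splits off the coefficient at
    one path.\<close>
  have lin: "f \<in> I" if "finite S" "f \<in> J" "\<forall>p. f p \<noteq> \<zero> \<longrightarrow> p \<in> S" for f S
    using that
  proof (induction S arbitrary: f rule: finite_induct)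
    case empty
    then have "f = \<zero>\<^bsub>P\<^esub>" by (auto simp: P_simps)
    then show ?case using P.zero_closed by simp
  next
    case (insert q S)
    define g where "g = f(q := \<zero>)"
    have g: "g p = (if p = q then \<zero> else f p)" for p by (simp add: g_def)
    have fc: "f \<in> carrier P" using insert.prems by (simp add: J_def)
    have "finite {p. g p \<noteq> \<zero>}" by (rule P_finite_supportI[OF fc]) (simp add: g)
    then have gc: "g \<in> carrier P"
      using fc by (intro P_carrierI) (auto simp: g P_carrierD(1))
    have "\<forall>p. reduced p \<longrightarrow> g p = \<zero>" using insert.prems(1) unfolding J_def g by simp
    with gc have "g \<in> J" unfolding J_def by blast
    then have gI: "g \<in> I"
      by (rule insert.IH) (use insert.prems(2) in \<open>auto simp: g\<close>)
    show ?case
    proof (cases "f q = \<zero>")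
      case True
      then have "g = f" by (auto simp: g)
      then show ?thesis using gI by simp
    next
      case False
      have q: "q \<in> quiver_paths Q" "\<not> reduced q"
        using False P_carrierD(1)[OF fc] insert.prems(1) unfolding J_def by blast+
      let ?e = "path_elem K q"
      have e: "?e \<in> I" "?e \<in> carrier P" using q not_reduced_in_ideal path_elem_closed by auto
      \<comment> \<open>So far \<open>I\<close> is known only as a ring ideal, so closure under
        scalars is obtained by multiplying with a scalar multiple of the unit.\<close>
      have "f q \<odot>\<^bsub>P\<^esub> ?e = (f q \<odot>\<^bsub>P\<^esub> \<one>\<^bsub>P\<^esub>) \<otimes>\<^bsub>P\<^esub> ?e"
        using fc e by (simp add: P_smult_mult)
      also have "\<dots> \<in> I" using fc e by (intro P.I_l_closed P_smult_closed) auto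
      finally have "g \<oplus>\<^bsub>P\<^esub> f q \<odot>\<^bsub>P\<^esub> ?e \<in> I"
        using gI by (intro additive_subgroup.a_closed[OF P.additive_subgroup_axioms])
      moreover have "g \<oplus>\<^bsub>P\<^esub> f q \<odot>\<^bsub>P\<^esub> ?e = f"
        using fc by (auto simp: P_simps g path_elem_def)
      ultimately show ?thesis by simp
    qed
  qed
  have "J \<subseteq> I"
  proof
    fix f assume f: "f \<in> J"
    then have "finite {p. f p \<noteq> \<zero>}" using P_carrierD(2) unfolding J_def by blast
    then show "f \<in> I" using f by (rule lin) blast
  qed
  with \<open>I \<subseteq> J\<close> have "I = J" by (rule subset_antisym)
  then have "f \<in> I \<longleftrightarrow> f \<in> J" by (rule arg_cong)
  then show ?thesis unfolding J_def by blast
qed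

lemma ideal_submodule: "submodule K I P"
proof -
  interpret V: vectorspace K P by (rule P_vectorspace)
  show ?thesis by unfold_locales (auto simp: ideal_iff P_simps)
qed

lemma A_simps:
  "f \<in> carrier P \<Longrightarrow> g \<in> carrier P \<Longrightarrow> \<pi> f \<otimes>\<^bsub>A\<^esub> \<pi> g = \<pi> (f \<otimes>\<^bsub>P\<^esub> g)"
  "f \<in> carrier P \<Longrightarrow> g \<in> carrier P \<Longrightarrow> \<pi> f \<oplus>\<^bsub>A\<^esub> \<pi> g = \<pi> (f \<oplus>\<^bsub>P\<^esub> g)"
  "c \<in> carrier K \<Longrightarrow> f \<in> carrier P \<Longrightarrow> c \<odot>\<^bsub>A\<^esub> \<pi> f = \<pi> (c \<odot>\<^bsub>P\<^esub> f)"
  "\<zero>\<^bsub>A\<^esub> = \<pi> \<zero>\<^bsub>P\<^esub>"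
  "carrier A = \<pi> ` carrier P"
proof -
  interpret V: vectorspace K P by (rule P_vectorspace)
  show "f \<in> carrier P \<Longrightarrow> g \<in> carrier P \<Longrightarrow> \<pi> f \<otimes>\<^bsub>A\<^esub> \<pi> g = \<pi> (f \<otimes>\<^bsub>P\<^esub> g)"
    by (simp add: quiver_algebra_def quotient_module_simps P.rcoset_mult_add)
  show "f \<in> carrier P \<Longrightarrow> g \<in> carrier P \<Longrightarrow> \<pi> f \<oplus>\<^bsub>A\<^esub> \<pi> g = \<pi> (f \<oplus>\<^bsub>P\<^esub> g)"
    by (simp add: quiver_algebra_def V.coset_add ideal_submodule)
  show "c \<in> carrier K \<Longrightarrow> f \<in> carrier P \<Longrightarrow> c \<odot>\<^bsub>A\<^esub> \<pi> f = \<pi> (c \<odot>\<^bsub>P\<^esub> f)"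
    by (simp add: quiver_algebra_def V.coset_smult ideal_submodule)
qed (use P.a_subset in \<open>simp_all add: quiver_algebra_def quotient_module_simps\<close>)

lemma coset_closed [simp]: "f \<in> carrier P \<Longrightarrow> \<pi> f \<in> carrier A"
  by (simp add: A_simps)

lemma A_assoc_algebra: "assoc_algebra K A"
proof -
  interpret V: vectorspace K P by (rule P_vectorspace)
  interpret A: vectorspace K A
    unfolding quiver_algebra_def by (intro V.quotient_module_vectorspace ideal_submodule)
  have "ring A"
  proof (rule ringI)
    show "abelian_group A" by unfold_locales
    have "\<one>\<^bsub>A\<^esub> = \<pi> \<one>\<^bsub>P\<^esub>" by (simp add: quiver_algebra_def quotient_module_simps)
    then show "Group.monoid A"
      by (intro monoidI) (auto simp: A_simps P.m_assoc)
  qed (auto simp: A_simps P.l_distr P.r_distr)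
  then show ?thesis
    by (auto simp: assoc_algebra_def assoc_algebra_axioms_def A.vectorspace_axioms A_simps
        P_smult_closed P_smult_mult)
qed

lemma coset_eq_iff:
  assumes "f \<in> carrier P" "g \<in> carrier P"
  shows "\<pi> f = \<pi> g \<longleftrightarrow> (\<forall>p. reduced p \<longrightarrow> f p = g p)"
proof -
  interpret V: vectorspace K P by (rule P_vectorspace)
  have "(f \<ominus>\<^bsub>P\<^esub> g) p = f p \<ominus> g p" for p
  proof -
    have "f \<ominus>\<^bsub>P\<^esub> g = f \<oplus>\<^bsub>P\<^esub> (\<ominus> \<one>) \<odot>\<^bsub>P\<^esub> g"
      using assms V.smult_minus_1[of g] by (simp add: a_minus_def)
    then show ?thesis using assms by (simp add: P_simps a_minus_def K.l_minus)
  qed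
  then show ?thesis
    using assms by (simp add: V.coset_eq_iff[OF ideal_submodule] ideal_iff)
qed

lemma coset_eqD:
  "\<lbrakk>f \<in> carrier P; g \<in> carrier P; \<pi> f = \<pi> g; reduced p\<rbrakk> \<Longrightarrow> f p = g p"
  using coset_eq_iff by blast

text \<open>The representative is an arbitrary choice; by \<open>coset_eq_iff\<close> its value does
  not depend on the choice when \<open>p\<close> is reduced.\<close>

definition coef :: "('v, 'e) path \<Rightarrow> (('v, 'e) path \<Rightarrow> 'k) set \<Rightarrow> 'k" where
  "coef p X = (SOME f. f \<in> carrier P \<and> X = \<pi> f) p"

lemma coef_coset:
  assumes "f \<in> carrier P" "reduced p"
  shows "coef p (\<pi> f) = f p"
proof -
  define g where "g = (SOME g. g \<in> carrier P \<and> \<pi> f = \<pi> g)"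
  have "g \<in> carrier P \<and> \<pi> f = \<pi> g"
    unfolding g_def by (rule someI[of _ f]) (use assms in simp)
  moreover have "coef p (\<pi> f) = g p" by (simp only: coef_def g_def)
  ultimately show ?thesis using coset_eqD[of f g p] assms by simp
qed

lemma coef_linear_functional:
  assumes "reduced p"
  shows "linear_functional K A (coef p)"
  using assms by (auto simp: linear_functional_def A_simps coef_coset P_simps P_smult_closed)

lemma coef_separates:
  assumes "X \<in> carrier A" "\<And>p. reduced p \<Longrightarrow> coef p X = \<zero>"
  shows "X = \<zero>\<^bsub>A\<^esub>"
proof -
  obtain f where f: "f \<in> carrier P" "X = \<pi> f" using assms(1) by (auto simp: A_simps)
  then show ?thesis using assms(2) by (auto simp: A_simps(4) coset_eq_iff coef_coset P_simps)
qed

theorem fin_dim_if_finite_reduced: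
  assumes "finite {p. reduced p}"
  shows "vectorspace.fin_dim K A" "vectorspace.fin_dim K (HH K A n)"
proof -
  interpret A: assoc_algebra K A by (rule A_assoc_algebra)
  show "A.fin_dim"
    using assms coef_linear_functional coef_separates
    by (intro A.fin_dim_if_separated[of "coef ` {p. reduced p}"]) auto
  show "vectorspace.fin_dim K (HH K A n)"
    using assms coef_linear_functional coef_separates
    by (intro A.HH_fin_dim_if_separated[of "coef ` {p. reduced p}"]) auto
qed

text \<open>A representative has finite support, and an injective sequence meets each path of the
  support at most once.\<close>

lemma coef_eventually_zero:
  assumes "X \<in> carrier A" "inj p" "\<And>n::nat. reduced (p n)"
  shows "\<exists>n0. \<forall>n\<ge>n0. coef (p n) X = \<zero>"
proof -
  obtain f where f: "f \<in> carrier P" "X = \<pi> f" using assms(1) by (auto simp: A_simps)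
  have "finite {n. f (p n) \<noteq> \<zero>}"
  proof (rule finite_imageD)
    show "finite (p ` {n. f (p n) \<noteq> \<zero>})"
      by (rule finite_subset[OF _ P_carrierD(2)[OF f(1)]]) auto
    show "inj_on p {n. f (p n) \<noteq> \<zero>}" using assms(2) by (rule inj_on_subset) simp
  qed
  then obtain m where "\<forall>n \<in> {n. f (p n) \<noteq> \<zero>}. n \<le> m" using finite_nat_set_iff_bounded_le by blast
  then have "\<forall>n\<ge>Suc m. coef (p n) X = \<zero>"
    using f assms(3) by (auto simp: coef_coset)
  then show ?thesis by blast
qed

text \<open>The criterion \<open>quotient_not_fin_dim\<close> is applied to \<open>P\<close> and
  \<open>I\<close> directly, with coefficients along an injective sequence of reduced paths as
  functionals.\<close>

theorem A_not_fin_dim: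
  assumes "infinite {p. reduced p}"
  shows "\<not> vectorspace.fin_dim K A"
proof -
  obtain p :: "nat \<Rightarrow> _" where p: "inj p" "range p \<subseteq> {p. reduced p}"
    using assms infinite_countable_subset by blast
  then have r: "reduced (p n)" for n by auto
  interpret V: vectorspace K P by (rule P_vectorspace)
  show ?thesis
    unfolding quiver_algebra_def
  proof (rule V.quotient_not_fin_dim[OF ideal_submodule, of "\<lambda>n f. f (p n)"])
    show "linear_functional K P (\<lambda>f. f (p n))" for n
      by (auto simp: linear_functional_def P_simps)
    show "f (p n) = \<zero>" if "f \<in> I" for f n using that r ideal_iff by blast
    show "\<exists>n0. \<forall>n\<ge>n0. f (p n) = \<zero>" if "f \<in> carrier P" for f
      using coef_eventually_zero[OF coset_closed[OF that] p(1) r] that r by (simp add: coef_coset)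
    show "\<exists>f \<in> carrier P. f (p n) \<noteq> \<zero>" for n
    proof
      show "path_elem K (p n) \<in> carrier P" using r[of n] by (intro path_elem_closed) (simp add: reduced_def)
      show "path_elem K (p n) (p n) \<noteq> \<zero>" by (simp add: path_elem_def)
    qed
  qed
qed

section \<open>The derivation counting an arrow\<close>

primrec weight :: "'e \<Rightarrow> 'e list \<Rightarrow> 'k" where
  "weight a [] = \<zero>"
| "weight a (x # xs) = (if x = a then \<one> else \<zero>) \<oplus> weight a xs"

lemma weight_closed [simp]: "weight a xs \<in> carrier K"
  by (induction xs) auto

lemma weight_append: "weight a (xs @ ys) = weight a xs \<oplus> weight a ys"
  by (induction xs) (auto simp: K.a_assoc)

lemma weight_eq_zero: "a \<notin> set xs \<Longrightarrow> weight a xs = \<zero>"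
  by (induction xs) auto

lemma weight_eq_one: "distinct xs \<Longrightarrow> a \<in> set xs \<Longrightarrow> weight a xs = \<one>"
  by (induction xs) (auto simp: weight_eq_zero)

definition weight_map :: "'e \<Rightarrow> (('v, 'e) path \<Rightarrow> 'k) \<Rightarrow> ('v, 'e) path \<Rightarrow> 'k" where
  "weight_map a f = (\<lambda>p. weight a (snd p) \<otimes> f p)"

lemma weight_map_closed:
  assumes "f \<in> carrier P"
  shows "weight_map a f \<in> carrier P"
proof -
  have "finite {p. weight_map a f p \<noteq> \<zero>}"
    by (rule P_finite_supportI[OF assms]) (simp add: weight_map_def)
  then show ?thesis
    using assms by (intro P_carrierI) (simp_all add: weight_map_def P_carrierD(1))
qed

text \<open>At every cut the weight of a path is the sum of the weights of its two pieces;
  distributing this sum in each summand of the convolution gives the Leibniz rule.\<close>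

lemma weight_map_mult:
  assumes f: "f \<in> carrier P" and g: "g \<in> carrier P"
  shows "weight_map a (f \<otimes>\<^bsub>P\<^esub> g) = weight_map a f \<otimes>\<^bsub>P\<^esub> g \<oplus>\<^bsub>P\<^esub> f \<otimes>\<^bsub>P\<^esub> weight_map a g"
proof (rule P_eqI)
  fix p assume p: "p \<in> quiver_paths Q"
  obtain u es where [simp]: "p = (u, es)" by (cases p)
  let ?f = "\<lambda>i. f (path_target Q (u, take i es), drop i es)" and ?g = "\<lambda>i. g (u, take i es)"
  have "weight_map a (f \<otimes>\<^bsub>P\<^esub> g) p = weight a es \<otimes> (\<Oplus>i\<in>{..length es}. ?f i \<otimes> ?g i)"
    using P_mult[OF f g] p by (simp add: weight_map_def)
  also have "\<dots> = (\<Oplus>i\<in>{..length es}. weight a es \<otimes> (?f i \<otimes> ?g i))"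
    using f g by (intro K.finsum_rdistr) auto
  also have "\<dots> = (\<Oplus>i\<in>{..length es}. (weight a (drop i es) \<otimes> ?f i) \<otimes> ?g i \<oplus>
      ?f i \<otimes> (weight a (take i es) \<otimes> ?g i))"
  proof (rule K.finsum_cong')
    fix i
    have w: "weight a es = weight a (take i es) \<oplus> weight a (drop i es)"
      by (metis append_take_drop_id weight_append)
    show "weight a es \<otimes> (?f i \<otimes> ?g i) = (weight a (drop i es) \<otimes> ?f i) \<otimes> ?g i \<oplus>
      ?f i \<otimes> (weight a (take i es) \<otimes> ?g i)"
      using f g by (simp add: w K.l_distr) (simp add: K.m_ac K.a_comm)
  qed (use f g in auto)
  also have "\<dots> = (weight_map a f \<otimes>\<^bsub>P\<^esub> g \<oplus>\<^bsub>P\<^esub> f \<otimes>\<^bsub>P\<^esub> weight_map a g) p"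
    using f g p weight_map_closed[OF f] weight_map_closed[OF g]
    by (simp add: P_simps P_mult K.finsum_addf Pi_def) (simp add: weight_map_def)
  finally show "weight_map a (f \<otimes>\<^bsub>P\<^esub> g) p =
    (weight_map a f \<otimes>\<^bsub>P\<^esub> g \<oplus>\<^bsub>P\<^esub> f \<otimes>\<^bsub>P\<^esub> weight_map a g) p" .
qed (use assms weight_map_closed in auto)

text \<open>The choice of the representative is harmless: \<open>weight_map\<close> rescales each
  coefficient separately, so representatives that agree on reduced paths still agree there
  afterwards.\<close>

definition weight_der :: "'e \<Rightarrow> (('v, 'e) path \<Rightarrow> 'k) set \<Rightarrow> (('v, 'e) path \<Rightarrow> 'k) set" where
  "weight_der a X = \<pi> (weight_map a (SOME f. f \<in> carrier P \<and> X = \<pi> f))"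

lemma weight_der_coset:
  assumes "f \<in> carrier P"
  shows "weight_der a (\<pi> f) = \<pi> (weight_map a f)"
proof -
  define g where "g = (SOME g. g \<in> carrier P \<and> \<pi> f = \<pi> g)"
  have g: "g \<in> carrier P \<and> \<pi> f = \<pi> g"
    unfolding g_def by (rule someI[of _ f]) (use assms in simp)
  then have "weight_map a g p = weight_map a f p" if "reduced p" for p
    using assms coset_eqD[of f g p] that by (simp add: weight_map_def)
  then have "\<pi> (weight_map a g) = \<pi> (weight_map a f)"
    using assms g coset_eq_iff[OF weight_map_closed weight_map_closed] by blast
  then show ?thesis by (simp only: weight_der_def g_def)
qed

lemma weight_der_hom: "weight_der a \<in> module_hom K A A"
proof -
  have "weight_map a (f \<oplus>\<^bsub>P\<^esub> g) = weight_map a f \<oplus>\<^bsub>P\<^esub> weight_map a g"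
    if "f \<in> carrier P" "g \<in> carrier P" for f g
    using that by (auto simp: P_simps weight_map_def K.r_distr)
  moreover have "weight_map a (c \<odot>\<^bsub>P\<^esub> f) = c \<odot>\<^bsub>P\<^esub> weight_map a f"
    if "f \<in> carrier P" "c \<in> carrier K" for f c
    using that by (auto simp: P_simps weight_map_def K.m_lcomm)
  ultimately show ?thesis
    by (auto simp: module_hom_def A_simps weight_der_coset weight_map_closed P_smult_closed)
qed

lemma weight_der_mult:
  assumes "X \<in> carrier A" "Y \<in> carrier A"
  shows "weight_der a (X \<otimes>\<^bsub>A\<^esub> Y) = weight_der a X \<otimes>\<^bsub>A\<^esub> Y \<oplus>\<^bsub>A\<^esub> X \<otimes>\<^bsub>A\<^esub> weight_der a Y"
  using assms by (auto simp: A_simps weight_der_coset weight_map_closed weight_map_mult)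

end


section \<open>Cocomplete cycles\<close>

lemma sublist_pair_iff: "sublist [x, y] xs \<longleftrightarrow> (\<exists>k. Suc k < length xs \<and> xs ! k = x \<and> xs ! Suc k = y)"
proof
  assume "sublist [x, y] xs"
  then obtain ps ss where "xs = ps @ [x, y] @ ss" by (auto simp: sublist_def)
  then show "\<exists>k. Suc k < length xs \<and> xs ! k = x \<and> xs ! Suc k = y"
    by (intro exI[of _ "length ps"]) (simp add: nth_append)
next
  assume "\<exists>k. Suc k < length xs \<and> xs ! k = x \<and> xs ! Suc k = y"
  then obtain k where k: "Suc k < length xs" "xs ! k = x" "xs ! Suc k = y" by blast
  then have "xs = take k xs @ [x, y] @ drop (Suc (Suc k)) xs"
    by (metis Cons_nth_drop_Suc Suc_lessD append_Cons append_Nil append_take_drop_id)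
  then show "sublist [x, y] xs" unfolding sublist_def by blast
qed

lemma sublist_pair_append_iff:
  "sublist [x, y] (xs @ ys) \<longleftrightarrow>
    sublist [x, y] xs \<or> sublist [x, y] ys \<or> xs \<noteq> [] \<and> ys \<noteq> [] \<and> x = last xs \<and> y = hd ys"
proof (induction xs)
  case (Cons z xs)
  have *: "sublist [x, y] (z # zs) \<longleftrightarrow> zs \<noteq> [] \<and> x = z \<and> y = hd zs \<or> sublist [x, y] zs" for zs
    by (cases zs) (auto simp: sublist_Cons_right)
  show ?case by (cases xs) (use Cons in \<open>auto simp: *\<close>)
qed simp

lemma (in wf_digraph) awalk_consecutive:
  assumes "awalk u es v" "Suc k < length es"
  shows "head G (es ! k) = tail G (es ! Suc k)"
proof -
  have "es = take k es @ es ! k # es ! Suc k # drop (Suc (Suc k)) es"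
    using assms(2) by (metis Cons_nth_drop_Suc Suc_lessD append_take_drop_id)
  then have "awalk u (take k es @ es ! k # es ! Suc k # drop (Suc (Suc k)) es) v"
    using assms(1) by simp
  then show ?thesis by (auto simp: awalk_Cons_iff)
qed

text \<open>\<open>c\<close> is the periodic sequence of arrows traversed by a cocomplete cycle, and \<open>L\<close> is its
  smallest period.\<close>

locale cocomplete_sequence = quiver_quotient K Q I
  for K :: "('k, 'm) ring_scheme" (structure) and Q :: "('v, 'e) pre_digraph" and I +
  fixes c :: "nat \<Rightarrow> 'e" and L :: nat
  assumes c_arc: "c i \<in> arcs Q"
    and c_step: "head Q (c i) = tail Q (c (Suc i))"
    and c_nonzero: "path_elem K (path2 Q (c (Suc i)) (c i)) \<notin> I"
    and next_unique: "\<lbrakk>b \<in> arcs Q; head Q (c i) = tail Q b; path_elem K (path2 Q b (c i)) \<notin> I\<rbrakk>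
      \<Longrightarrow> b = c (Suc i)"
    and prev_unique: "\<lbrakk>b \<in> arcs Q; head Q b = tail Q (c (Suc i)); path_elem K (path2 Q (c (Suc i)) b) \<notin> I\<rbrakk>
      \<Longrightarrow> b = c i"
    and L_pos: "0 < L"
    and c_period: "c (i + L) = c i"
    and c_inj: "\<lbrakk>i < j; j < i + L\<rbrakk> \<Longrightarrow> c i \<noteq> c j"
begin

section \<open>Subpaths of the periodic sequence\<close>

lemma c_mult_period: "c (i + n * L) = c i"
proof (induction n)
  case (Suc n)
  then show ?case using c_period[of "i + n * L"] by (simp add: ac_simps)
qed simp

text \<open>\<open>window m (n * L)\<close> is the \<open>n\<close>-th power of the cycle, rotated
  so that it starts with \<open>c m\<close>.\<close>

definition window :: "nat \<Rightarrow> nat \<Rightarrow> ('v, 'e) path" where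
  "window m n = (tail Q (c m), map c [m..<m + n])"

lemma window_walk: "awalk (tail Q (c m)) (map c [m..<m + n]) (tail Q (c (m + n)))"
proof (induction n arbitrary: m)
  case 0
  then show ?case by (simp add: awalk_Nil_iff c_arc)
next
  case (Suc n)
  show ?case using Suc[of "Suc m"] by (simp add: upt_conv_Cons awalk_Cons_iff c_arc c_step del: upt_Suc)
qed

lemma window_target: "path_target Q (window m n) = tail Q (c (m + n))"
  using window_walk[of m n] by (auto simp: path_target_def window_def)

lemma window_reduced: "reduced (window m n)"
  unfolding reduced_def
proof (intro conjI allI impI)
  show "window m n \<in> quiver_paths Q"
    using window_walk[of m n] window_target[of m n] by (simp add: window_def mem_quiver_paths_iff)
  show "path_elem K (path2 Q a b) \<notin> I" if "sublist [b, a] (snd (window m n))" for a b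
    using that c_nonzero by (auto simp: window_def sublist_pair_iff)
qed

lemma window_append: "map c [m..<m + (i + j)] = map c [m..<m + i] @ map c [m + i..<m + i + j]"
  using upt_add_eq_append[of m "m + i" j] by (simp add: add.assoc)

lemma window_shift: "window (m + n * L) k = window m k"
proof -
  have "c (m + n * L + i) = c (m + i)" for i
    using c_mult_period[of "m + i" n] by (simp add: ac_simps)
  then have "map c [m + n * L..<m + n * L + k] = map c [m..<m + k]"
    by (intro nth_equalityI) auto
  then show ?thesis by (simp add: window_def c_mult_period)
qed

lemma window_mod: "window m k = window (m mod L) k"
  using window_shift[of "m mod L" "m div L" k] by simp

lemma window_eqD: "window m k = window n l \<Longrightarrow> k = l"
  by (auto simp: window_def dest: arg_cong[of _ _ length])

text \<open>One arrow of the cycle determines the whole path: \<open>next_unique\<close> forces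
  everything after it and \<open>prev_unique\<close> everything before it.\<close>

lemma reduced_eq_window:
  assumes r: "reduced (u, es)" and k: "k < length es" "es ! k = c i"
  shows "\<exists>m. (u, es) = window m (length es)"
proof -
  have w: "awalk u es (path_target Q (u, es))"
    using r by (simp add: reduced_def mem_quiver_paths_iff)
  have step: "head Q (es ! j) = tail Q (es ! Suc j)"
    "path_elem K (path2 Q (es ! Suc j) (es ! j)) \<notin> I" if "Suc j < length es" for j
    using awalk_consecutive[OF w that] r that by (auto simp: reduced_def sublist_pair_iff)
  have arc: "es ! j \<in> arcs Q" if "j < length es" for j
    using w that by (auto simp: awalk_def)
  \<comment> \<open>The window has to start \<open>k\<close> positions before \<open>i\<close>.
    Adding \<open>k\<close> full periods first keeps the subtraction of natural numbers
    exact.\<close>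
  define m where "m = i + k * L - k"
  have "k \<le> i + k * L" using L_pos by (simp add: trans_le_add2)
  then have mk: "c (m + k) = es ! k" using k by (simp add: m_def c_mult_period)
  have forward: "es ! (k + j) = c (m + (k + j))" if "k + j < length es" for j
    using that
  proof (induction j)
    case (Suc j)
    then have "es ! (k + j) = c (m + (k + j))" by simp
    then show ?case
      using next_unique[of "es ! Suc (k + j)" "m + (k + j)"] step[of "k + j"] arc[of "Suc (k + j)"] Suc.prems
      by simp
  qed (simp add: mk)
  have backward: "es ! (k - j) = c (m + (k - j))" if "j \<le> k" for j
    using that
  proof (induction j)
    case (Suc j)
    then have *: "k - j = Suc (k - Suc j)" "es ! (k - j) = c (m + (k - j))" by auto
    then show ?case
      using prev_unique[of "es ! (k - Suc j)" "m + (k - Suc j)"] step[of "k - Suc j"]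
        arc[of "k - Suc j"] k(1) by simp
  qed (simp add: mk)
  have "es ! j = c (m + j)" if "j < length es" for j
    using forward[of "j - k"] backward[of "k - j"] that by (cases "k \<le> j") auto
  then have es: "es = map c [m..<m + length es]" by (intro nth_equalityI) auto
  moreover have "u = tail Q (c m)"
  proof -
    have "es = es ! 0 # tl es" using k by (cases es) auto
    moreover have "es ! 0 = c m" using es k by (metis add_0_right length_greater_0_conv less_zeroE list.size(3) nth_map_upt add_diff_cancel_left')
    ultimately show ?thesis using w by (metis awalk_Cons_iff)
  qed
  ultimately show ?thesis unfolding window_def by auto
qed

text \<open>The sum of all rotations of the \<open>n\<close>-th power of the cycle.\<close>

definition cycle_sum :: "nat \<Rightarrow> ('v, 'e) path \<Rightarrow> 'k" where
  "cycle_sum n = (\<lambda>p. if \<exists>m. p = window m (n * L) then \<one> else \<zero>)"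

text \<open>The support is finite because the starting index of a window matters only modulo
  \<open>L\<close>.\<close>

lemma cycle_sum_closed: "cycle_sum n \<in> carrier P"
proof (rule P_carrierI)
  have "window m (n * L) \<in> (\<lambda>m. window m (n * L)) ` {..<L}" for m
    using window_mod[of m "n * L"] L_pos by (intro image_eqI[of _ _ "m mod L"]) auto
  then have "{p. cycle_sum n p \<noteq> \<zero>} \<subseteq> (\<lambda>m. window m (n * L)) ` {..<L}"
    by (auto simp: cycle_sum_def)
  then show "finite {p. cycle_sum n p \<noteq> \<zero>}" by (rule finite_subset) simp
  show "cycle_sum n p = \<zero>" if "p \<notin> quiver_paths Q" for p
    using that window_reduced by (auto simp: cycle_sum_def reduced_def)
qed (auto simp: cycle_sum_def)

lemma cycle_sum_eq_zero: "length es \<noteq> n * L \<Longrightarrow> cycle_sum n (u, es) = \<zero>"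
  by (auto simp: cycle_sum_def window_def)

text \<open>The required length \<open>n * L\<close> of one factor leaves a single cut. In the
  second product \<open>f\<close> is read at the window starting at \<open>m + n * L\<close>, which
  periodicity identifies with the one starting at \<open>m\<close>; this is why the two products
  agree.\<close>

lemma cycle_sum_mult_window:
  assumes f: "f \<in> carrier P"
  shows "(cycle_sum n \<otimes>\<^bsub>P\<^esub> f) (window m (n * L + k)) = f (window m k)"
    and "(f \<otimes>\<^bsub>P\<^esub> cycle_sum n) (window m (n * L + k)) = f (window m k)"
proof -
  have one: "cycle_sum n (window i (n * L)) = \<one>" for i by (auto simp: cycle_sum_def)
  have path: "(tail Q (c m), map c [m..<m + (n * L + k)]) \<in> quiver_paths Q"
    using window_reduced[of m "n * L + k"] by (simp add: reduced_def window_def)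
  have split1: "map c [m..<m + (n * L + k)] = map c [m..<m + k] @ map c [m + k..<m + k + n * L]"
    using window_append[of m k "n * L"] by (simp add: add.commute)
  have split2: "map c [m..<m + (n * L + k)] = map c [m..<m + n * L] @ map c [m + n * L..<m + n * L + k]"
    by (rule window_append)
  have "(cycle_sum n \<otimes>\<^bsub>P\<^esub> f) (tail Q (c m), map c [m..<m + k] @ map c [m + k..<m + k + n * L]) =
    cycle_sum n (path_target Q (tail Q (c m), map c [m..<m + k]), map c [m + k..<m + k + n * L]) \<otimes>
    f (tail Q (c m), map c [m..<m + k])"
  proof (rule P_mult_eq_single[OF cycle_sum_closed f path[unfolded split1]])
    fix xs ys :: "'e list"
    assume "xs @ ys = map c [m..<m + k] @ map c [m + k..<m + k + n * L]"
      and l: "length xs \<noteq> length (map c [m..<m + k])"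
    then have "length xs + length ys = k + n * L" by (metis length_append length_map length_upt add_diff_cancel_left')
    then have "cycle_sum n (path_target Q (tail Q (c m), xs), ys) = \<zero>"
      using l by (intro cycle_sum_eq_zero) simp
    then show "cycle_sum n (path_target Q (tail Q (c m), xs), ys) = \<zero> \<or> f (tail Q (c m), xs) = \<zero>" ..
  qed
  then show "(cycle_sum n \<otimes>\<^bsub>P\<^esub> f) (window m (n * L + k)) = f (window m k)"
    using one[of "m + k"] window_target[of m k] f
    by (simp only: window_def split1) simp
  have "(f \<otimes>\<^bsub>P\<^esub> cycle_sum n) (tail Q (c m), map c [m..<m + n * L] @ map c [m + n * L..<m + n * L + k]) =
    f (path_target Q (tail Q (c m), map c [m..<m + n * L]), map c [m + n * L..<m + n * L + k]) \<otimes>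
    cycle_sum n (tail Q (c m), map c [m..<m + n * L])"
    by (rule P_mult_eq_single[OF f cycle_sum_closed path[unfolded split2]]) (simp add: cycle_sum_eq_zero)
  then show "(f \<otimes>\<^bsub>P\<^esub> cycle_sum n) (window m (n * L + k)) = f (window m k)"
    using one[of m] window_target[of m "n * L"] f window_shift[of m n k]
    by (simp only: window_def split2) simp
qed

text \<open>Positivity of \<open>n\<close> matters: \<open>cycle_sum 0\<close> is the sum of the
  trivial paths at the vertices of the cycle and need not be central.\<close>

lemma cycle_sum_central:
  assumes f: "f \<in> carrier P" and n: "0 < n" and r: "reduced p"
  shows "(cycle_sum n \<otimes>\<^bsub>P\<^esub> f) p = (f \<otimes>\<^bsub>P\<^esub> cycle_sum n) p"
proof (cases "\<exists>m k. p = window m (n * L + k)")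
  case True
  then show ?thesis using cycle_sum_mult_window[OF f] by auto
next
  case False
  obtain u es where p: "p = (u, es)" by (cases p)
  have path: "(u, es) \<in> quiver_paths Q" using r p by (simp add: reduced_def)
  \<comment> \<open>A piece of \<open>es\<close> that is a positive power of the cycle contains an
    arrow of the sequence, so all of \<open>es\<close> would be a window of length at least
    \<open>n * L\<close>, which this case excludes. Hence every summand of both products
    vanishes.\<close>
  have no: "\<not> (sublist xs es \<and> xs = map c [m..<m + n * L])" for xs m
  proof
    assume "sublist xs es \<and> xs = map c [m..<m + n * L]"
    then obtain ps ss where es: "es = ps @ map c [m..<m + n * L] @ ss" by (auto simp: sublist_def)
    then have "es ! length ps = c m" "length ps < length es" "length es = n * L + (length ps + length ss)"
      using n L_pos by (auto simp: nth_append)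
    then obtain m' where "(u, es) = window m' (n * L + (length ps + length ss))"
      using reduced_eq_window[of u es "length ps" m] r p by auto
    then show False using False p by blast
  qed
  have "cycle_sum n (v, drop i es) = \<zero>" "cycle_sum n (v, take i es) = \<zero>" for v i
    using no[of "drop i es"] no[of "take i es"] by (auto simp: cycle_sum_def window_def)
  then show ?thesis
    using f cycle_sum_closed by (simp add: p P_mult path)
qed

text \<open>Every rotation of the cycle contains \<open>c 0\<close> exactly once: at least once
  because \<open>L\<close> is a period, at most once by \<open>c_inj\<close>.\<close>

lemma cycle_sum_weight: "weight_map (c 0) (cycle_sum 1) = cycle_sum 1"
proof
  fix p
  show "weight_map (c 0) (cycle_sum 1) p = cycle_sum 1 p"
  proof (cases "\<exists>m. p = window m L")
    case True
    then obtain m where p: "p = window m L" by blast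
    have "distinct (map c [m..<m + L])"
    proof -
      have "inj_on c {m..<m + L}" by (rule linorder_inj_onI') (simp add: c_inj)
      then show ?thesis by (simp add: distinct_map)
    qed
    moreover have "c 0 \<in> set (map c [m..<m + L])"
    proof -
      \<comment> \<open>This is \<open>m\<close> divided by \<open>L\<close>, rounded up, so
        \<open>q * L\<close> is the multiple of \<open>L\<close> that lies in the window starting at
        \<open>m\<close>.\<close>
      define q where "q = (m + L - 1) div L"
      have "q * L + (m + L - 1) mod L = m + L - 1" unfolding q_def by simp
      moreover have "(m + L - 1) mod L < L" using L_pos by simp
      ultimately have "m \<le> q * L" "q * L < m + L" using L_pos by linarith+
      moreover have "c (q * L) = c 0" using c_mult_period[of 0 q] by simp
      ultimately show ?thesis by (auto intro: image_eqI[of _ _ "q * L"])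
    qed
    ultimately have "weight (c 0) (snd p) = \<one>" by (simp add: p window_def weight_eq_one)
    then show ?thesis using cycle_sum_closed by (simp add: weight_map_def)
  next
    case False
    then show ?thesis by (simp add: weight_map_def cycle_sum_def)
  qed
qed

lemma coset_cycle_sum_central:
  assumes "X \<in> carrier A" "0 < n"
  shows "\<pi> (cycle_sum n) \<otimes>\<^bsub>A\<^esub> X = X \<otimes>\<^bsub>A\<^esub> \<pi> (cycle_sum n)"
proof -
  obtain f where f: "f \<in> carrier P" "X = \<pi> f" using assms(1) by (auto simp: A_simps)
  then have "\<pi> (cycle_sum n \<otimes>\<^bsub>P\<^esub> f) = \<pi> (f \<otimes>\<^bsub>P\<^esub> cycle_sum n)"
    using cycle_sum_central[OF f(1) assms(2)] cycle_sum_closed[of n]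
    by (subst coset_eq_iff) auto
  then show ?thesis using f cycle_sum_closed by (simp add: A_simps)
qed

section \<open>Infinite dimension from a cocomplete sequence\<close>

lemma inj_window: "inj (\<lambda>n. window 0 ((n + k) * L))"
  using L_pos by (auto intro!: injI dest: window_eqD)

theorem infinite_reduced: "infinite {p. reduced p}"
proof
  assume "finite {p. reduced p}"
  then have "finite (range (\<lambda>n. window 0 ((n + 0) * L)))"
    by (rule finite_subset[rotated]) (auto simp: window_reduced)
  then show False using inj_window[of 0] finite_imageD infinite_UNIV_nat by blast
qed

theorem HH_0_infinite: "\<not> vectorspace.fin_dim K (HH K A 0)"
proof -
  interpret A: assoc_algebra K A by (rule A_assoc_algebra)
  show ?thesis
  \<comment> \<open>The exponent is \<open>n + 1\<close> because centrality of
    \<open>cycle_sum\<close> is available for positive exponents.\<close>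
  proof (rule A.HH_0_not_fin_dim[where \<psi> = "\<lambda>n. coef (window 0 ((n + 1) * L))"
        and z = "\<lambda>n. \<pi> (cycle_sum (n + 1))"])
    show "\<exists>n0. \<forall>n\<ge>n0. coef (window 0 ((n + 1) * L)) X = \<zero>" if "X \<in> carrier A" for X
      using that by (intro coef_eventually_zero inj_window window_reduced)
    show "coef (window 0 ((n + 1) * L)) (\<pi> (cycle_sum (n + 1))) \<noteq> \<zero>" for n
      unfolding coef_coset[OF cycle_sum_closed window_reduced] by (auto simp: cycle_sum_def)
  qed (auto simp: coef_linear_functional window_reduced cycle_sum_closed coset_cycle_sum_central)
qed

theorem HH_1_infinite: "\<not> vectorspace.fin_dim K (HH K A 1)"
proof -
  interpret A: assoc_algebra K A by (rule A_assoc_algebra)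
  show ?thesis
  \<comment> \<open>The derivation fixes \<open>w\<close>, the first power. Multiplying it by the
    power \<open>n + 1\<close> gives coefficient one at length \<open>(n + 2) * L\<close>, which is
    where the functional reads.\<close>
  proof (rule A.HH_1_not_fin_dim[where \<psi> = "\<lambda>n. coef (window 0 ((n + 2) * L))"
        and z = "\<lambda>n. \<pi> (cycle_sum (n + 1))" and w = "\<pi> (cycle_sum 1)" and E = "weight_der (c 0)"])
    show "\<exists>n0. \<forall>n\<ge>n0. coef (window 0 ((n + 2) * L)) X = \<zero>" if "X \<in> carrier A" for X
      using that by (intro coef_eventually_zero inj_window window_reduced)
    show "weight_der (c 0) (X \<otimes>\<^bsub>A\<^esub> Y) = weight_der (c 0) X \<otimes>\<^bsub>A\<^esub> Y \<oplus>\<^bsub>A\<^esub> X \<otimes>\<^bsub>A\<^esub> weight_der (c 0) Y"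
      if "X \<in> carrier A" "Y \<in> carrier A" for X Y using that by (rule weight_der_mult)
    show "coef (window 0 ((n + 2) * L)) (\<pi> (cycle_sum (n + 1)) \<otimes>\<^bsub>A\<^esub> weight_der (c 0) (\<pi> (cycle_sum 1))) \<noteq> \<zero>"
      for n
    proof -
      have "\<pi> (cycle_sum (n + 1)) \<otimes>\<^bsub>A\<^esub> weight_der (c 0) (\<pi> (cycle_sum 1)) =
        \<pi> (cycle_sum (n + 1) \<otimes>\<^bsub>P\<^esub> cycle_sum 1)"
        by (simp only: weight_der_coset[OF cycle_sum_closed] cycle_sum_weight A_simps cycle_sum_closed)
      moreover have "coef (window 0 ((n + 2) * L)) (\<pi> (cycle_sum (n + 1) \<otimes>\<^bsub>P\<^esub> cycle_sum 1)) =
        (cycle_sum (n + 1) \<otimes>\<^bsub>P\<^esub> cycle_sum 1) (window 0 ((n + 1) * L + L))"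
        by (subst coef_coset) (auto simp: cycle_sum_closed window_reduced algebra_simps)
      moreover have "\<dots> = \<one>"
        unfolding cycle_sum_mult_window(1)[OF cycle_sum_closed] by (auto simp: cycle_sum_def)
      ultimately show ?thesis by simp
    qed
  qed (auto simp: coef_linear_functional window_reduced cycle_sum_closed coset_cycle_sum_central
      weight_der_hom)
qed

end

text \<open>If a reduced path meets an arrow \<open>a\<close> twice, the stretch from the first
  \<open>a\<close> up to just before the second is a cocomplete cycle. Without such cycles a reduced
  path has distinct arrows, which bounds its length.\<close>

lemma (in quiver_quotient) finite_reduced_if_no_cocomplete_cycle:
  assumes fin: "fin_digraph Q" and no: "\<nexists>C. cocomplete_cycle K Q I C"
  shows "finite {p. reduced p}"
proof (rule finite_subset)
  interpret Q: fin_digraph Q by fact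
  show "finite (verts Q \<times> {es. set es \<subseteq> arcs Q \<and> length es \<le> card (arcs Q)})"
    by (intro finite_cartesian_product finite_lists_length_le) auto
  show "{p. reduced p} \<subseteq> verts Q \<times> {es. set es \<subseteq> arcs Q \<and> length es \<le> card (arcs Q)}"
  proof
    fix p assume "p \<in> {p. reduced p}"
    then obtain u es where p: "p = (u, es)" "reduced (u, es)" by (cases p) auto
    then have w: "awalk u es (path_target Q (u, es))" by (simp add: reduced_def mem_quiver_paths_iff)
    have "distinct es"
    proof (rule ccontr)
      assume "\<not> distinct es"
      then obtain xs ys zs a where es: "es = xs @ [a] @ ys @ [a] @ zs"
        using not_distinct_decomp by blast
      have "awalk (path_target Q (u, xs)) (a # ys @ a # zs) (path_target Q (u, es))"
        using w by (auto simp: es path_target_def)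
      then have "awalk (tail Q a) (a # ys) (tail Q a)"
        by (auto simp: awalk_Cons_iff awalk_append_iff[of _ ys "a # zs"])
      then have "quiver_cycle Q (a # ys)" by (auto simp: quiver_cycle_def)
      \<comment> \<open>The consecutive pairs of the doubled cycle already occur in
        \<open>(a # ys) @ [a]\<close>: the wraparound pair ends in the second occurrence of
        \<open>a\<close>, which belongs to \<open>es\<close>.\<close>
      moreover have "sublist [d, b] es" if "sublist [d, b] ((a # ys) @ (a # ys))" for b d
      proof -
        have "sublist [d, b] ((a # ys) @ [a])"
          using that unfolding sublist_pair_append_iff by auto
        moreover have "sublist ((a # ys) @ [a]) es" unfolding es using sublist_appendI[of "(a # ys) @ [a]" xs zs] by simp
        ultimately show ?thesis by (meson sublist_order.order.trans)
      qed
      ultimately have "cocomplete_cycle K Q I (a # ys)"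
        using p(2) by (auto simp: cocomplete_cycle_def reduced_def)
      then show False using no by blast
    qed
    moreover have "set es \<subseteq> arcs Q" "u \<in> verts Q" using w by auto
    ultimately show "p \<in> verts Q \<times> {es. set es \<subseteq> arcs Q \<and> length es \<le> card (arcs Q)}"
      using card_mono[of "arcs Q" "set es"] by (auto simp: p distinct_card)
  qed
qed

text \<open>\<open>C\<close> may run several times around a shorter cycle. Unrolling it and passing
  to the first return of \<open>c 0\<close> yields a period without repeated arrows.\<close>

lemma (in quiver_quotient) cocomplete_sequence_exists:
  assumes gentle: "gentle_presentation K Q I" and C: "cocomplete_cycle K Q I C"
  shows "\<exists>c L. cocomplete_sequence K Q I c L"
proof -
  obtain u where u: "awalk u C u" and ne: "C \<noteq> []"
    using C by (auto simp: cocomplete_cycle_def quiver_cycle_def)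
  define N where "N = length C"
  have N: "0 < N" using ne by (simp add: N_def)
  define c where "c i = C ! (i mod N)" for i
  have w: "awalk u (C @ C) u" using u by (auto intro: awalk_appendI)
  \<comment> \<open>In \<open>C @ C\<close> the step from the last arrow of \<open>C\<close> back to
    the first is also a pair of consecutive entries, so the wraparound needs no separate
    treatment.\<close>
  have pair: "c i = (C @ C) ! (i mod N)" "c (Suc i) = (C @ C) ! Suc (i mod N)"
    "Suc (i mod N) < length (C @ C)" for i
  proof -
    have l: "i mod N < N" using N by simp
    then show "c i = (C @ C) ! (i mod N)" "Suc (i mod N) < length (C @ C)"
      by (auto simp: c_def N_def nth_append)
    show "c (Suc i) = (C @ C) ! Suc (i mod N)"
      using l by (auto simp: c_def nth_append mod_Suc N_def)
  qed
  have arc: "c i \<in> arcs Q" for i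
    using u N by (auto simp: c_def N_def awalk_def)
  have step: "head Q (c i) = tail Q (c (Suc i))" for i
    using awalk_consecutive[OF w pair(3)[of i]] pair[of i] by simp
  have nz: "path_elem K (path2 Q (c (Suc i)) (c i)) \<notin> I" for i
  proof -
    have "sublist [c i, c (Suc i)] (C @ C)"
      unfolding sublist_pair_iff using pair[of i] by (intro exI[of _ "i mod N"]) auto
    then show ?thesis using C by (simp add: cocomplete_cycle_def)
  qed
  have nxt: "b = c (Suc i)"
    if "b \<in> arcs Q" "head Q (c i) = tail Q b" "path_elem K (path2 Q b (c i)) \<notin> I" for b i
  proof -
    have "\<exists>\<^sub>\<le>\<^sub>1 b. b \<in> arcs Q \<and> head Q (c i) = tail Q b \<and> path_elem K (path2 Q b (c i)) \<notin> I"
      using gentle arc[of i] unfolding gentle_presentation_def by blast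
    then show ?thesis
      using that arc[of "Suc i"] step[of i] nz[of i] by (auto dest: Uniq_D)
  qed
  have prv: "b = c i"
    if "b \<in> arcs Q" "head Q b = tail Q (c (Suc i))" "path_elem K (path2 Q (c (Suc i)) b) \<notin> I" for b i
  proof -
    have "\<exists>\<^sub>\<le>\<^sub>1 b. b \<in> arcs Q \<and> head Q b = tail Q (c (Suc i)) \<and> path_elem K (path2 Q (c (Suc i)) b) \<notin> I"
      using gentle arc[of "Suc i"] unfolding gentle_presentation_def by blast
    then show ?thesis
      using that arc[of i] step[of i] nz[of i] by (auto dest: Uniq_D)
  qed
  define L where "L = (LEAST l. 0 < l \<and> c l = c 0)"
  have "0 < N \<and> c N = c 0" using N by (simp add: c_def)
  then have "0 < L \<and> c L = c 0" unfolding L_def by (rule LeastI)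
  then have L: "0 < L" "c L = c 0" by simp_all
  have least: "L \<le> l" if "0 < l" "c l = c 0" for l
    unfolding L_def using that by (intro Least_le) simp
  \<comment> \<open>One return to \<open>c 0\<close> suffices: as successors are forced, the
    equality propagates forwards.\<close>
  have "c (i + L) = c i" for i
  proof (induction i)
    case (Suc i)
    then have "c (Suc (i + L)) = c (Suc i)"
      using arc[of "Suc (i + L)"] step[of "i + L"] nz[of "i + L"] by (intro nxt) auto
    then show ?case by simp
  qed (simp add: L)
  \<comment> \<open>Predecessors are forced as well, so a repetition after fewer than
    \<open>L\<close> steps can be pulled back to index 0, where it contradicts the minimality of
    \<open>L\<close>.\<close>
  moreover have "c i \<noteq> c j" if "i < j" "j < i + L" for i j
  proof
    assume eq: "c i = c j"
    have "c (i - t) = c (j - t)" if "t \<le> i" for t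
      using that
    proof (induction t)
      case (Suc t)
      then have s: "i - t = Suc (i - Suc t)" "j - t = Suc (j - Suc t)" "c (i - t) = c (j - t)"
        using \<open>i < j\<close> by auto
      have "c (j - Suc t) = c (i - Suc t)"
        using arc[of "j - Suc t"] step[of "j - Suc t"] nz[of "j - Suc t"] s by (intro prv) auto
      then show ?case by simp
    qed (simp add: eq)
    from this[of i] have "c (j - i) = c 0" by simp
    then show False using least[of "j - i"] that by simp
  qed
  ultimately have "cocomplete_sequence K Q I c L"
    using arc step nz nxt prv L(1) by unfold_locales
  then show ?thesis by blast
qed

theorem corollary3p13:
  fixes K :: "('k, 'm) ring_scheme"
    and Q :: "('v, 'e) pre_digraph"
    and I :: "(('v, 'e) path \<Rightarrow> 'k) set"
    and A :: "('k, (('v, 'e) path \<Rightarrow> 'k) set) module"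
  assumes "field K"
    and "fin_digraph Q"
    and "connected Q"
    and "gentle_presentation K Q I"
    and "A = quiver_algebra K Q I"
  shows "(vectorspace.fin_dim K A \<longleftrightarrow> vectorspace.fin_dim K (HH K A 0)) \<and>
         (vectorspace.fin_dim K (HH K A 0) \<longleftrightarrow> vectorspace.fin_dim K (HH K A 1)) \<and>
         (vectorspace.fin_dim K (HH K A 1) \<longleftrightarrow> \<not> (\<exists>C. cocomplete_cycle K Q I C)) \<and>
         (vectorspace.fin_dim K A \<longrightarrow> (\<forall>m. vectorspace.fin_dim K (HH K A m)))"
proof -
  interpret quiver_quotient K Q I
    using assms(1,4)
    by (auto simp: quiver_quotient_def quiver_quotient_axioms_def gentle_presentation_def)
  show ?thesis
  proof (cases "\<exists>C. cocomplete_cycle K Q I C")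
    case True
    then obtain c L where "cocomplete_sequence K Q I c L"
      using cocomplete_sequence_exists[OF assms(4)] by blast
    then interpret cocomplete_sequence K Q I c L .
    show ?thesis
      using True A_not_fin_dim[OF infinite_reduced] HH_0_infinite HH_1_infinite
      unfolding assms(5) by blast
  next
    case False
    then have "finite {p. reduced p}"
      using finite_reduced_if_no_cocomplete_cycle[OF assms(2)] by blast
    then show ?thesis
      using False fin_dim_if_finite_reduced unfolding assms(5) by blast
  qed
qed

end
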